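(* Let $n\ge2$, $x_1,\dots,x_n>0$, and consider the multispecies PushTASEP on the ring of $n$ sites with content $\lambda=(n-1,\dots,1,0)$ in its stationary distribution. For integers $0\le i,j\le n-1$, the joint probability $\langle\eta^{(j)}_1\eta^{(i)}_2\rangle$ of seeing the particle of species $j$ at site $1$ and that of species $i$ at site $2$ is as follows. If $j<i$: $$\langle\eta^{(j)}_1\eta^{(i)}_2\rangle=x_1x_2^2\,\frac{f_{j,i}(x_1,\dots,x_n)}{e_{(n-j,\,n-j-1,\,n-i,\,n-i-1)}(x_1,\dots,x_n)}.$$ If $j=i$: $\langle\eta^{(j)}_1\eta^{(i)}_2\rangle=0$. If $j=i+1$: $$\langle\eta^{(j)}_1\eta^{(i)}_2\rangle=\frac{g_{i+1,i}(x_1,\dots,x_n)}{e_{(n-i,\,n-i-1,\,n-i-1,\,n-i-2)}(x_1,\dots,x_n)}+x_1x_2\,\frac{s_{\langle2^{n-j-1}\rangle}(x_3,\dots,x_n)}{e_{(n-j,\,n-j)}(x_1,\dots,x_n)}.$$ If $j>i+1$: $$\langle\eta^{(j)}_1\eta^{(i)}_2\rangle=\frac{g_{j,i}(x_1,\dots,x_n)}{e_{(n-i,\,n-i-1,\,n-j,\,n-j-1)}(x_1,\dots,x_n)}.$$ Here $$f_{j,i}(x_1,\dots,x_n)=\det\begin{pmatrix} 1 & s_{\langle2^{n-j-2}\rangle}(x_3,\dots,x_n) & s_{\langle2^{n-i-2}\rangle}(x_3,\dots,x_n) \\ -x_1-x_2 & s_{\langle1^1,2^{n-j-2}\rangle}(x_3,\dots,x_n)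 & s_{\langle1^1,2^{n-i-2}\rangle}(x_3,\dots,x_n) \\ {x_1x_2} & s_{\langle2^{n-j-1}\rangle}(x_3,\dots,x_n) & s_{\langle2^{n-i-1}\rangle}(x_3,\dots,x_n) \end{pmatrix}$$ and $$g_{j,i}(x_1,\dots,x_n)=\sum_{a,b=0}^2x_1^{3-a}x_2^{3-b}\,s_{(2^{n-i-2},a)}(x_3,\dots,x_n)\,s_{(2^{n-j-2},b)}(x_3,\dots,x_n).$$
   Context: **Multispecies PushTASEP with content $(n-1,\dots,1,0)$.** The sites $1,\dots,n$ are arranged clockwise on a ring (site $n$ is followed by site $1$). Configurations are permutations $\eta=(\eta_1,\dots,\eta_n)$ of $(n-1,\dots,1,0)$; $\eta_j=r\ge1$ means that site $j$ holds the particle of species $r$, and $\eta_j=0$ means that site $j$ is vacant (the vacancy is regarded as the "particle of species $0$"). It is the continuous-time Markov chain in which a bell rings at each site $j$ independently at rate $1/x_j$. If site $j$ is vacant when its bell rings, nothing changes. Otherwise let $i_1=\eta_j$; this particle moves to the first site $j_2$ clockwise from $j$ with $i_2:=\eta_{j_2}<i_1$. If $i_2=0$ the jump is complete; otherwise the displaced particle of species $i_2$ moves to the first site $j_3$ clockwise from $j_2$ with $\eta_{j_3}<i_2$, and so on until a vacancy is filled. All these moves occur instantaneously and site $j$ is left vacant. The chain is irreducible; $\langle\cdot\rangle$ denotes expectation in its unique stationary distribution. $\eta^{(i)}_k$ is the indicator that site $k$ is occupied by species $i$. **Symmetric functions.** $e_m(x_1,\dots,x_n)=\sum_{1\le i_1<\cdots<i_m\le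 n}x_{i_1}\cdots x_{i_m}$, $e_0=1$, and $e_{(\mu_1,\mu_2,\dots)}=\prod_i e_{\mu_i}$. $s_\mu$ is the Schur polynomial, $s_\mu(y_1,\dots,y_N)=\det(y_i^{\mu_j+N-j})/\det(y_i^{N-j})$; it is $0$ if $\mu$ has more than $N$ nonzero parts, and $s_\emptyset=1$. $\langle1^{m_1},2^{m_2}\rangle$ is the partition with $m_2$ parts equal to $2$ and $m_1$ parts equal to $1$, with $s_{\langle1^{m_1},2^{m_2}\rangle}=0$ if $m_2<0$. For $a\in\{0,1,2\}$ and an integer $m\ge-1$, $s_{(2^m,a)}$ denotes $s_{\langle2^m\rangle}$, $s_{\langle1^1,2^m\rangle}$, $s_{\langle2^{m+1}\rangle}$ for $a=0,1,2$ respectively (with the same vanishing convention). *)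

theory Defs
  imports
    "HOL-Probability.Probability_Mass_Function"
    "HOL-Library.Poly_Mapping"
    "Jordan_Normal_Form.Determinant"
begin

section \<open>The multispecies PushTASEP on a ring\<close>

definition configs :: "nat \<Rightarrow> (nat \<Rightarrow> nat) set" where
  "configs n = {\<eta> \<in> extensional {1..n}. bij_betw \<eta> {1..n} {0..<n}}"

text \<open>The site reached from site \<open>k\<close> by \<open>d\<close> clockwise steps; sites are numbered \<open>1, \<dots>, n\<close>.\<close>

definition clockwise :: "nat \<Rightarrow> nat \<Rightarrow> nat \<Rightarrow> nat" where
  "clockwise n k d = (k - 1 + d) mod n + 1"

definition first_below :: "nat \<Rightarrow> (nat \<Rightarrow> nat) \<Rightarrow> nat \<Rightarrow> nat \<Rightarrow> nat" where
  "first_below n \<eta> k r = clockwise n k (LEAST d. 1 \<le> d \<and> \<eta> (clockwise n k d) < r)"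

text \<open>
  A particle of species \<open>r\<close> starts moving from site \<open>k\<close>, takes the first site \<open>k'\<close> holding a
  smaller species, and the species displaced from \<open>k'\<close> moves on in the same way. Species \<open>0\<close>
  is the vacancy, which ends the cascade. The case \<open>\<not> \<eta> k' < r\<close> only serves termination:
  it does not occur when some site is vacant. Site \<open>k\<close> itself is not emptied here.
\<close>

function push :: "nat \<Rightarrow> nat \<Rightarrow> nat \<Rightarrow> (nat \<Rightarrow> nat) \<Rightarrow> (nat \<Rightarrow> nat)" where
  "push n k r \<eta> =
     (let k' = first_below n \<eta> k r
      in if r = 0 \<or> \<not> \<eta> k' < r then \<eta> else push n k' (\<eta> k') (\<eta>(k' := r)))"
  by pat_completeness auto
termination
  by (relation "Wellfounded.measure (\<lambda>(n, k, r, \<eta>). r)") auto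

declare push.simps [simp del]

definition ring_bell :: "nat \<Rightarrow> nat \<Rightarrow> (nat \<Rightarrow> nat) \<Rightarrow> (nat \<Rightarrow> nat)" where
  "ring_bell n j \<eta> = (if \<eta> j = 0 then \<eta> else (push n j (\<eta> j) \<eta>)(j := 0))"

text \<open>
  The matrix entry \<open>Q(\<eta>, \<xi>)\<close> of the generator: the bell at site \<open>j\<close> rings at rate \<open>1 / x j\<close>.
\<close>

definition generator :: "nat \<Rightarrow> (nat \<Rightarrow> real) \<Rightarrow> (nat \<Rightarrow> nat) \<Rightarrow> (nat \<Rightarrow> nat) \<Rightarrow> real" where
  "generator n x \<eta> \<xi> =
     (\<Sum>j = 1..n. 1 / x j * (of_bool (ring_bell n j \<eta> = \<xi>) - of_bool (\<eta> = \<xi>)))"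

definition stationary :: "nat \<Rightarrow> (nat \<Rightarrow> real) \<Rightarrow> (nat \<Rightarrow> nat) pmf \<Rightarrow> bool" where
  "stationary n x \<pi> \<longleftrightarrow>
     set_pmf \<pi> \<subseteq> configs n \<and>
     (\<forall>\<xi> \<in> configs n. (\<Sum>\<eta> \<in> configs n. pmf \<pi> \<eta> * generator n x \<eta> \<xi>) = 0)"

definition occ :: "nat \<Rightarrow> nat \<Rightarrow> (nat \<Rightarrow> nat) \<Rightarrow> real" where
  "occ i k \<eta> = of_bool (\<eta> k = i)"


section \<open>Symmetric polynomials\<close>

definition elem_sym :: "nat \<Rightarrow> (nat \<Rightarrow> real) \<Rightarrow> nat \<Rightarrow> real" where
  "elem_sym n x m = (\<Sum>S | S \<subseteq> {1..n} \<and> card S = m. \<Prod>i\<in>S. x i)"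

definition elem_sym_list :: "nat \<Rightarrow> (nat \<Rightarrow> real) \<Rightarrow> nat list \<Rightarrow> real" where
  "elem_sym_list n x \<mu> = prod_list (map (elem_sym n x) \<mu>)"

text \<open>
  The quotient of alternants defining a Schur polynomial is a quotient of polynomials; as a
  quotient of numbers it would be meaningless when two arguments coincide. It is therefore
  formed in the polynomial ring (monomials are exponent functions \<open>nat \<Rightarrow>\<^sub>0 nat\<close>, the
  variables are numbered from \<open>0\<close>) and evaluated afterwards.
\<close>

type_synonym mpoly = "(nat \<Rightarrow>\<^sub>0 nat) \<Rightarrow>\<^sub>0 real"

definition var :: "nat \<Rightarrow> mpoly" where
  "var i = Poly_Mapping.single (Poly_Mapping.single i 1) 1"

definition eval_mpoly :: "(nat \<Rightarrow> real) \<Rightarrow> mpoly \<Rightarrow> real" where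
  "eval_mpoly y p =
     (\<Sum>m \<in> Poly_Mapping.keys p.
        Poly_Mapping.lookup p m * (\<Prod>i \<in> Poly_Mapping.keys m. y i ^ Poly_Mapping.lookup m i))"

definition part :: "nat list \<Rightarrow> nat \<Rightarrow> nat" where
  "part \<mu> j = (if j < length \<mu> then \<mu> ! j else 0)"

text \<open>Rows and columns are numbered from \<open>0\<close>, so the exponent \<open>\<mu>\<^sub>j + N - j\<close> becomes
  \<open>\<mu>\<^sub>j + N - (j + 1)\<close>.\<close>

definition alternant :: "nat \<Rightarrow> nat list \<Rightarrow> mpoly" where
  "alternant N \<mu> = Determinant.det (mat N N (\<lambda>(i, j). var i ^ (part \<mu> j + (N - Suc j))))"

definition schur_poly :: "nat \<Rightarrow> nat list \<Rightarrow> mpoly" where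
  "schur_poly N \<mu> =
     (if N < length (filter (\<lambda>p. p \<noteq> 0) \<mu>) then 0
      else THE p. p * alternant N [] = alternant N \<mu>)"

definition schur :: "nat list \<Rightarrow> real list \<Rightarrow> real" where
  "schur \<mu> ys = eval_mpoly (\<lambda>i. ys ! i) (schur_poly (length ys) \<mu>)"

definition schur12 :: "nat \<Rightarrow> int \<Rightarrow> real list \<Rightarrow> real" where
  "schur12 m1 m2 ys =
     (if m2 < 0 then 0 else schur (replicate (nat m2) 2 @ replicate m1 1) ys)"

text \<open>\<open>s\<^bsub>(2\<^sup>m, a)\<^esub>\<close> for \<open>a \<in> {0, 1, 2}\<close>.\<close>

definition schur2a :: "int \<Rightarrow> nat \<Rightarrow> real list \<Rightarrow> real" where
  "schur2a m a ys =
     (if a = 0 then schur12 0 m ys else if a = 1 then schur12 1 m ys else schur12 0 (m + 1) ys)"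

text \<open>The arguments \<open>x 3, \<dots>, x n\<close>; the list is empty for \<open>n = 2\<close>.\<close>

definition xs_from3 :: "nat \<Rightarrow> (nat \<Rightarrow> real) \<Rightarrow> real list" where
  "xs_from3 n x = map x [3..<n + 1]"

definition f_fun :: "nat \<Rightarrow> nat \<Rightarrow> nat \<Rightarrow> (nat \<Rightarrow> real) \<Rightarrow> real" where
  "f_fun n j i x =
     (let ys = xs_from3 n x; J = int n - int j; I = int n - int i in
      Determinant.det (mat_of_rows_list 3
        [[1,            schur12 0 (J - 2) ys, schur12 0 (I - 2) ys],
         [- x 1 - x 2,  schur12 1 (J - 2) ys, schur12 1 (I - 2) ys],
         [x 1 * x 2,    schur12 0 (J - 1) ys, schur12 0 (I - 1) ys]]))"

definition g_fun :: "nat \<Rightarrow> nat \<Rightarrow> nat \<Rightarrow> (nat \<Rightarrow> real) \<Rightarrow> real" where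
  "g_fun n j i x =
     (let ys = xs_from3 n x in
      \<Sum>a = 0..2. \<Sum>b = 0..2. x 1 ^ (3 - a) * x 2 ^ (3 - b)
        * schur2a (int n - int i - 2) a ys * schur2a (int n - int j - 2) b ys)"

end

theory Submission
  imports Defs
begin

text \<open>
  Each level set \<open>{s. t \<le> \<eta> s}\<close>, \<open>t \<ge> 1\<close>, is a single-species PushTASEP driven by the same bells:
  a bell at an occupied site moves its particle to the next vacant site. The probability in
  question is a second difference, in the two thresholds, of the probability that two given level
  sets contain the sites 1 and 2, so only pairs of level sets \<open>A \<subset> B\<close> matter.

  The stationary law of such a pair comes from a two-line queue. Take independent random sets
  \<open>R\<close> and \<open>B\<close> of the prescribed sizes with weights \<open>\<Prod>x\<close>, and let \<open>A\<close> be the set of sites of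
  \<open>B\<close> that serve the customers arriving at the sites of \<open>R\<close>. The stationary law is unique because
  ringing the bells \<open>1, \<dots>, n\<close> in turn leads to the same pair from everywhere.

  If site 1 or 2 carries an unused service, the ring can be cut there, and a reflection argument on
  the sites \<open>3, \<dots>, n\<close> gives expressions \<open>e\<^sub>a e\<^sub>b - e\<^sub>c e\<^sub>d\<close> in \<open>x\<^sub>3, \<dots>, x\<^sub>n\<close>. By Pieri's rule the
  two-column Schur polynomials are of this form too, and the theorem becomes a polynomial identity.
\<close>

section \<open>Two-column Schur polynomials\<close>

text \<open>The cases of the theorem reflect the order of the two thresholds. For level sets
  \<open>A\<close> inside \<open>B\<close>, the events that site 1 lies in \<open>A\<close> and that
  site 2 lies in \<open>B\<close> turn out to be independent. If \<open>j > i + 1\<close>, site 1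
  has the higher threshold in all four terms of the second difference, which is therefore a product
  of two first differences; this is \<open>g_fun\<close>. If \<open>j = i + 1\<close>, one of the
  four terms has equal thresholds, and correcting the product there produces the extra Schur term.
  With \<open>B\<close> at site 1 and \<open>A\<close> at site 2 independence fails, but the
  numerator is still bilinear, and its second difference is the determinant \<open>f_fun\<close>.
  The obstacle is that a queue on a ring has no starting point: its length at a site depends on
  itself.\<close>

definition monom_eval :: "(nat \<Rightarrow> real) \<Rightarrow> (nat \<Rightarrow>\<^sub>0 nat) \<Rightarrow> real" where
  "monom_eval y m = (\<Prod>i \<in> Poly_Mapping.keys m. y i ^ Poly_Mapping.lookup m i)"

lemma monom_eval_superset:
  assumes "finite K" "Poly_Mapping.keys m \<subseteq> K"
  shows "monom_eval y m = (\<Prod>i\<in>K. y i ^ Poly_Mapping.lookup m i)"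
  unfolding monom_eval_def using assms
  by (intro prod.mono_neutral_left) (auto simp: in_keys_iff)

lemma monom_eval_add: "monom_eval y (m + m') = monom_eval y m * monom_eval y m'"
proof -
  let ?K = "Poly_Mapping.keys m \<union> Poly_Mapping.keys m'"
  have "monom_eval y (m + m') = (\<Prod>i\<in>?K. y i ^ Poly_Mapping.lookup (m + m') i)"
    using Poly_Mapping.keys_add[of m m'] by (intro monom_eval_superset) auto
  also have "\<dots> = (\<Prod>i\<in>?K. y i ^ Poly_Mapping.lookup m i) * (\<Prod>i\<in>?K. y i ^ Poly_Mapping.lookup m' i)"
    by (simp add: lookup_add power_add prod.distrib)
  also have "\<dots> = monom_eval y m * monom_eval y m'"
    by (simp add: monom_eval_superset[of ?K])
  finally show ?thesis .
qed

lemma eval_mpoly_add: "eval_mpoly y (p + q) = eval_mpoly y p + eval_mpoly y q"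
  unfolding eval_mpoly_def
  by (rule setsum_keys_plus_distrib) (auto simp: algebra_simps)

lemma eval_mpoly_0 [simp]: "eval_mpoly y 0 = 0"
  by (simp add: eval_mpoly_def)

lemma eval_mpoly_sum: "eval_mpoly y (sum f A) = (\<Sum>a\<in>A. eval_mpoly y (f a))"
  by (induction A rule: infinite_finite_induct) (auto simp: eval_mpoly_add)

lemma eval_mpoly_diff: "eval_mpoly y (p - q) = eval_mpoly y p - eval_mpoly y q"
  using eval_mpoly_add[of y "p - q" q] by simp

lemma eval_mpoly_single: "eval_mpoly y (Poly_Mapping.single m c) = c * monom_eval y m"
  by (simp add: eval_mpoly_def monom_eval_def)

lemma poly_mapping_eq_sum_single:
  "p = (\<Sum>m\<in>Poly_Mapping.keys p. Poly_Mapping.single m (Poly_Mapping.lookup p m))"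
  by (rule poly_mapping_eqI)
    (auto simp: lookup_sum lookup_single when_def sum.If_cases in_keys_iff if_distrib cong: if_cong)

lemma eval_mpoly_mult: "eval_mpoly y (p * q) = eval_mpoly y p * eval_mpoly y q"
proof -
  let ?s = "\<lambda>p m. Poly_Mapping.single m (Poly_Mapping.lookup p m)"
  have "p * q = (\<Sum>m\<in>Poly_Mapping.keys p. \<Sum>m'\<in>Poly_Mapping.keys q. ?s p m * ?s q m')"
    by (subst poly_mapping_eq_sum_single[of p], subst poly_mapping_eq_sum_single[of q])
      (simp add: sum_product)
  then have "eval_mpoly y (p * q) =
      (\<Sum>m\<in>Poly_Mapping.keys p. \<Sum>m'\<in>Poly_Mapping.keys q.
        (Poly_Mapping.lookup p m * monom_eval y m) * (Poly_Mapping.lookup q m' * monom_eval y m'))"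
    by (simp add: eval_mpoly_sum mult_single eval_mpoly_single monom_eval_add algebra_simps)
  then show ?thesis
    by (simp add: sum_product eval_mpoly_def monom_eval_def)
qed

lemma eval_mpoly_1 [simp]: "eval_mpoly y 1 = 1"
  using eval_mpoly_single[of y 0 1] by (simp add: monom_eval_def)

lemma eval_mpoly_prod: "eval_mpoly y (prod f A) = (\<Prod>a\<in>A. eval_mpoly y (f a))"
  by (induction A rule: infinite_finite_induct) (auto simp: eval_mpoly_mult)

lemma eval_mpoly_var [simp]: "eval_mpoly y (var i) = y i"
  by (simp add: var_def eval_mpoly_single monom_eval_def)

section \<open>Alternants and multiplication by elementary symmetric polynomials\<close>

definition elem_mpoly :: "nat \<Rightarrow> nat \<Rightarrow> mpoly" where
  "elem_mpoly N b = (\<Sum>S | S \<subseteq> {..<N} \<and> card S = b. \<Prod>i\<in>S. var i)"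

text \<open>The exponents are arbitrary, so that a strip may be added to any set of columns;
  repeated exponents then give zero.\<close>

definition gen_alternant :: "nat \<Rightarrow> (nat \<Rightarrow> nat) \<Rightarrow> mpoly" where
  "gen_alternant N \<alpha> = Determinant.det (mat N N (\<lambda>(i, j). var i ^ \<alpha> j))"

lemma gen_alternant_leibniz:
  "gen_alternant N \<alpha> = (\<Sum>p | p permutes {..<N}. signof p * (\<Prod>j<N. var (p j) ^ \<alpha> j))"
proof -
  have "gen_alternant N \<alpha> = (\<Sum>p | p permutes {..<N}. signof p *
      (\<Prod>j<N. mat N N (\<lambda>(i, j). var i ^ \<alpha> j) $$ (p j, j)))"
    unfolding gen_alternant_def
    by (rule trans[OF det_col[where n=N]]) (simp, simp only: atLeast0LessThan)
  also have "\<dots> = (\<Sum>p | p permutes {..<N}. signof p * (\<Prod>j<N. var (p j) ^ \<alpha> j))"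
  proof (intro sum.cong refl)
    fix p assume "p \<in> {p. p permutes {..<N}}"
    then have "p j < N" if "j < N" for j using permutes_in_image[of p "{..<N}" j] that by simp
    then show "signof p * (\<Prod>j<N. mat N N (\<lambda>(i, j). var i ^ \<alpha> j) $$ (p j, j)) =
        signof p * (\<Prod>j<N. var (p j) ^ \<alpha> j)" by simp
  qed
  finally show ?thesis .
qed

lemma gen_alternant_eq_0:
  assumes "i < N" "j < N" "i \<noteq> j" "\<alpha> i = \<alpha> j"
  shows "gen_alternant N \<alpha> = 0"
  unfolding gen_alternant_def using assms
  by (intro det_identical_columns[of _ N i j]) auto

lemma gen_alternant_cong: "(\<And>j. j < N \<Longrightarrow> \<alpha> j = \<beta> j) \<Longrightarrow> gen_alternant N \<alpha> = gen_alternant N \<beta>"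
  by (simp add: gen_alternant_leibniz)

text \<open>The symmetry is stated with \<open>p\<close> inside the variables, so that the factor
  can be absorbed into the Leibniz term of the same \<open>p\<close>.\<close>

lemma elem_mpoly_permute:
  assumes "p permutes {..<N}"
  shows "elem_mpoly N b = (\<Sum>T | T \<subseteq> {..<N} \<and> card T = b. \<Prod>j\<in>T. var (p j))"
proof -
  have inj: "inj p" using assms by (rule permutes_inj)
  have "elem_mpoly N b = (\<Sum>T | T \<subseteq> {..<N} \<and> card T = b. \<Prod>j\<in>p ` T. var j)"
    unfolding elem_mpoly_def
  proof (rule sum.reindex_bij_betw[symmetric], rule bij_betwI[where g="\<lambda>T. inv_into UNIV p ` T"])
    show "(`) p \<in> {T. T \<subseteq> {..<N} \<and> card T = b} \<rightarrow> {S. S \<subseteq> {..<N} \<and> card S = b}"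
      using permutes_in_image[OF assms] inj by (auto simp: card_image inj_on_subset[OF inj])
    have inv: "inv_into UNIV p permutes {..<N}" using assms by (rule permutes_inv)
    then have "inj (inv_into UNIV p)" by (rule permutes_inj)
    then show "(`) (inv_into UNIV p) \<in> {S. S \<subseteq> {..<N} \<and> card S = b} \<rightarrow> {T. T \<subseteq> {..<N} \<and> card T = b}"
      using permutes_in_image[OF inv] by (auto simp: card_image inj_on_subset)
  qed (use assms in \<open>auto simp: image_image permutes_inverses\<close>)
  also have "\<dots> = (\<Sum>T | T \<subseteq> {..<N} \<and> card T = b. \<Prod>j\<in>T. var (p j))"
    by (intro sum.cong refl) (simp add: prod.reindex inj_on_subset[OF inj])
  finally show ?thesis .
qed

text \<open>In each Leibniz term the monomial indexed by \<open>T\<close> raises by one exactly the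
  exponents of the columns in \<open>T\<close>.\<close>

lemma elem_mpoly_mult_alternant:
  "elem_mpoly N b * gen_alternant N \<alpha> =
     (\<Sum>T | T \<subseteq> {..<N} \<and> card T = b. gen_alternant N (\<lambda>j. \<alpha> j + of_bool (j \<in> T)))"
proof -
  let ?F = "{T. T \<subseteq> {..<N} \<and> card T = b}"
  have "elem_mpoly N b * gen_alternant N \<alpha> =
      (\<Sum>p | p permutes {..<N}. \<Sum>T\<in>?F. signof p * (\<Prod>j<N. var (p j) ^ (\<alpha> j + of_bool (j \<in> T))))"
    unfolding gen_alternant_leibniz sum_distrib_left
  proof (intro sum.cong refl)
    fix p assume "p \<in> {p. p permutes {..<N}}"
    then have p: "p permutes {..<N}" by simp
    have "(\<Prod>j<N. var (p j) ^ (\<alpha> j + of_bool (j \<in> T))) =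
        (\<Prod>j\<in>T. var (p j)) * (\<Prod>j<N. var (p j) ^ \<alpha> j)" if "T \<in> ?F" for T
    proof -
      have "(\<Prod>j<N. var (p j) ^ of_bool (j \<in> T)) = (\<Prod>j\<in>T. var (p j))"
        using that by (intro prod.mono_neutral_cong_right) auto
      then show ?thesis by (simp add: power_add prod.distrib mult.commute)
    qed
    then show "elem_mpoly N b * (signof p * (\<Prod>j<N. var (p j) ^ \<alpha> j)) =
        (\<Sum>T\<in>?F. signof p * (\<Prod>j<N. var (p j) ^ (\<alpha> j + of_bool (j \<in> T))))"
      by (simp add: elem_mpoly_permute[OF p] sum_distrib_right sum_distrib_left algebra_simps)
  qed
  also have "\<dots> = (\<Sum>T\<in>?F. gen_alternant N (\<lambda>j. \<alpha> j + of_bool (j \<in> T)))"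
    by (subst sum.swap) (simp add: gen_alternant_leibniz)
  finally show ?thesis .
qed

lemma var_power_prod:
  "finite A \<Longrightarrow> (\<Prod>j\<in>A. var (f j) ^ \<alpha> j) =
     Poly_Mapping.single (\<Sum>j\<in>A. Poly_Mapping.single (f j) (\<alpha> j)) 1"
proof (induction A rule: finite_induct)
  case (insert a A)
  have "var i ^ k = Poly_Mapping.single (Poly_Mapping.single i k) 1" for i k
    by (induction k) (simp_all add: var_def mult_single single_add[symmetric])
  then show ?case using insert by (simp add: mult_single)
qed simp

text \<open>The exponents \<open>N - Suc j\<close> are distinct, so the diagonal monomial arises
  from the identity permutation alone and has coefficient 1. This allows the denominator of a Schur
  polynomial to be cancelled.\<close>

lemma alternant_empty_nonzero: "alternant N [] \<noteq> 0"
proof -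
  let ?\<delta> = "\<lambda>j. N - Suc j"
  let ?m = "\<lambda>p :: nat \<Rightarrow> nat. \<Sum>j<N. Poly_Mapping.single (p j) (?\<delta> j)"
  have lookup: "Poly_Mapping.lookup (?m p) (p i) = ?\<delta> i" if "p permutes {..<N}" "i < N" for p i
  proof -
    have "Poly_Mapping.lookup (?m p) (p i) = (\<Sum>j<N. if j = i then ?\<delta> j else 0)"
      unfolding lookup_sum lookup_single when_def
      using permutes_inj[OF that(1)] by (intro sum.cong refl) (auto simp: inj_eq)
    then show ?thesis using that by simp
  qed
  have p_id: "p = id" if p: "p permutes {..<N}" and eq: "?m p = ?m id" for p
  proof
    fix i show "p i = id i"
    proof (cases "i < N")
      case True
      then have "p i < N" using permutes_in_image[OF p] by auto
      then have "?\<delta> i = ?\<delta> (p i)"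
        using lookup[OF p True] lookup[of id "p i"] eq by (simp add: permutes_id)
      then show ?thesis using True \<open>p i < N\<close> by simp
    qed (use p in \<open>auto simp: permutes_def\<close>)
  qed
  have sg: "(signof p :: mpoly) = Poly_Mapping.single 0 (signof p)" for p :: "nat \<Rightarrow> nat"
    by (auto simp: sign_def single_uminus)
  have "alternant N [] = gen_alternant N ?\<delta>"
    by (simp add: alternant_def gen_alternant_def part_def)
  also have "\<dots> = (\<Sum>p | p permutes {..<N}. Poly_Mapping.single (?m p) (signof p))"
    unfolding gen_alternant_leibniz by (simp add: var_power_prod sg mult_single del: single_of_int)
  finally have "Poly_Mapping.lookup (alternant N []) (?m id) =
      (\<Sum>p | p permutes {..<N}. signof p when ?m p = ?m id)"
    by (simp add: lookup_sum lookup_single)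
  also have "\<dots> = (\<Sum>p\<in>{id}. signof p when ?m p = ?m id)"
    by (intro sum.mono_neutral_right)
      (auto simp: finite_permutations permutes_id when_def dest: p_id)
  also have "\<dots> = 1" by (simp add: sign_id)
  finally show ?thesis by auto
qed

lemma downward_closed_eq_lessThan:
  fixes D :: "nat set"
  assumes "finite D" and down: "\<And>j. Suc j \<in> D \<Longrightarrow> j \<in> D"
  shows "D = {..<card D}"
proof -
  have le: "i \<in> D" if "j \<in> D" "i \<le> j" for i j
    using that(2,1) by (induction rule: inc_induct) (auto dest: down)
  have "\<exists>m. m \<notin> D" using ex_new_if_finite[OF infinite_UNIV_nat \<open>finite D\<close>] .
  then obtain m where m: "m \<notin> D" "\<And>k. k < m \<Longrightarrow> k \<in> D"
    using LeastI_ex[of "\<lambda>m. m \<notin> D"] not_less_Least[of _ "\<lambda>m. m \<notin> D"] by blast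
  have "D = {..<m}"
    using m le by (meson lessThan_iff not_less subsetI subset_antisym)
  then show ?thesis by simp
qed

text \<open>For \<open>c \<le> d\<close>, the numerator of the Schur polynomial whose diagram has
  columns of heights \<open>d\<close> and \<open>c\<close>: two column indicators on top of the
  staircase.\<close>

definition two_column_alternant :: "nat \<Rightarrow> nat \<Rightarrow> nat \<Rightarrow> mpoly" where
  "two_column_alternant N c d =
     gen_alternant N (\<lambda>j. of_bool (j < c) + of_bool (j < d) + (N - Suc j))"

text \<open>Pieri's rule for a one-column shape: every other way of adding a vertical strip produces
  two equal columns in the alternant.\<close>

lemma elem_mpoly_mult_column:
  assumes "a \<le> N"
  shows "elem_mpoly N b * two_column_alternant N 0 a =
    (\<Sum>c | c \<le> a \<and> c \<le> b \<and> a + b - c \<le> N. two_column_alternant N c (a + b - c))"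
proof -
  let ?\<alpha> = "\<lambda>j. of_bool (j < (0::nat)) + of_bool (j < a) + (N - Suc j)"
  let ?F = "{T. T \<subseteq> {..<N} \<and> card T = b}"
  let ?C = "{c. c \<le> a \<and> c \<le> b \<and> a + b - c \<le> N}"
  \<comment> \<open>The strips that survive: \<open>c\<close> boxes start a second column and the
    other \<open>b - c\<close> prolong the first.\<close>
  let ?T = "\<lambda>c. {..<c} \<union> {a..<a + b - c}"
  let ?A = "\<lambda>T. gen_alternant N (\<lambda>j. ?\<alpha> j + of_bool (j \<in> T))"
  have card_T: "card (?T c) = b" if "c \<in> ?C" for c
    using that by (subst card_Un_disjoint) auto
  have "?T c \<inter> {..<a} = {..<c}" if "c \<in> ?C" for c
    using that by auto
  then have inj: "inj_on ?T ?C"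
    by (intro inj_onI) (metis card_lessThan)
  have zero: "?A T = 0" if T: "T \<in> ?F - ?T ` ?C" for T
  proof -
    have fin: "finite T" using T finite_subset by blast
    \<comment> \<open>At such a \<open>j\<close> neighbouring exponents differ by one and the strip
      closes the gap. At \<open>Suc j = a\<close> the gap is two, so the columns stay distinct.
      Without such a \<open>j\<close>, \<open>T\<close> is an initial segment on either side of
      \<open>a\<close>.\<close>
    have "\<exists>j. Suc j \<in> T \<and> j \<notin> T \<and> Suc j \<noteq> a"
    proof (rule ccontr)
      assume "\<not> ?thesis"
      then have cl: "\<And>j. Suc j \<in> T \<Longrightarrow> Suc j \<noteq> a \<Longrightarrow> j \<in> T" by blast
      let ?D = "T \<inter> {..<a}" and ?E = "{i. a + i \<in> T}"
      have D: "?D = {..<card ?D}"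
        using cl fin by (intro downward_closed_eq_lessThan) auto
      have "finite ?E" using fin finite_imageD[of "(+) a" ?E] finite_subset[of "(+) a ` ?E" T] by auto
      then have E: "?E = {..<card ?E}"
        using cl by (intro downward_closed_eq_lessThan) auto
      have T_eq: "T = ?D \<union> (+) a ` ?E"
        by (auto simp: image_iff) (metis le_Suc_ex not_le)
      have "card T = card ?D + card ((+) a ` ?E)"
        using fin \<open>finite ?E\<close> by (subst T_eq, subst card_Un_disjoint) auto
      then have b: "b = card ?D + card ?E" using T by (simp add: card_image)
      have sub: "(+) a ` ?E = {a..<a + card ?E}"
        by (subst E) (simp add: lessThan_atLeast0 add.commute)
      have le: "card ?D \<le> a" using card_mono[of "{..<a}" ?D] by simp
      have "a + card ?E \<le> N"
      proof (cases "card ?E")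
        case (Suc k)
        then have "a + k \<in> (+) a ` ?E" unfolding sub by simp
        then show ?thesis using T Suc by auto
      qed (use assms in simp)
      then have "card ?D \<in> ?C" using b le by simp
      moreover have "T = ?T (card ?D)"
        using T_eq D sub b by simp
      ultimately show False using T by blast
    qed
    then obtain j where j: "Suc j \<in> T" "j \<notin> T" "Suc j \<noteq> a" by blast
    then have "Suc j < N" using T by blast
    then show ?thesis using j by (intro gen_alternant_eq_0[of j N "Suc j"]) auto
  qed
  have "elem_mpoly N b * two_column_alternant N 0 a = (\<Sum>T\<in>?F. ?A T)"
    unfolding two_column_alternant_def elem_mpoly_mult_alternant ..
  also have "\<dots> = (\<Sum>T\<in>?T ` ?C. ?A T)"
  proof (rule sum.mono_neutral_right)
    show "?T ` ?C \<subseteq> ?F" using card_T assms by fastforce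
  qed (use zero finite_subset[of ?F "Pow {..<N}"] in auto)
  also have "\<dots> = (\<Sum>c\<in>?C. ?A (?T c))"
    by (simp add: sum.reindex[OF inj])
  also have "\<dots> = (\<Sum>c\<in>?C. two_column_alternant N c (a + b - c))"
    unfolding two_column_alternant_def
    by (intro sum.cong refl gen_alternant_cong) auto
  finally show ?thesis .
qed

lemma elem_mpoly_eq_0: "N < b \<Longrightarrow> elem_mpoly N b = 0"
proof -
  assume "N < b"
  have "False" if "S \<subseteq> {..<N}" "card S = b" for S
    using card_mono[OF finite_lessThan that(1)] that(2) \<open>N < b\<close> by simp
  then have empty: "{S. S \<subseteq> {..<N} \<and> card S = b} = {}" by blast
  show ?thesis unfolding elem_mpoly_def empty by simp
qed

lemma elem_mpoly_mult_empty:
  "elem_mpoly N b * alternant N [] = (if b \<le> N then two_column_alternant N 0 b else 0)"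
proof -
  have "alternant N [] = two_column_alternant N 0 0"
    by (simp add: alternant_def two_column_alternant_def gen_alternant_def part_def)
  moreover have "{c. c \<le> 0 \<and> c \<le> b \<and> 0 + b - c \<le> N} = (if b \<le> N then {0} else {})"
    by auto
  ultimately show ?thesis
    using elem_mpoly_mult_column[of 0 N b] by (simp split: if_splits)
qed

text \<open>Dual Jacobi-Trudi: the two Pieri expansions share all terms with \<open>c < b\<close>,
  and their difference leaves the term \<open>c = b\<close>. The case \<open>b = 0\<close> is
  separate because \<open>b - 1\<close> is truncated.\<close>

lemma two_column_schur_numerator:
  assumes "b \<le> a" "a \<le> N"
  shows "(elem_mpoly N b * elem_mpoly N a
      - (if b = 0 then 0 else elem_mpoly N (b - 1) * elem_mpoly N (a + 1))) * alternant N []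
    = two_column_alternant N b a"
proof -
  let ?V = "two_column_alternant N" and ?S = "\<lambda>m. {c. c < m \<and> a + b - c \<le> N}"
  have 1: "elem_mpoly N b * elem_mpoly N a * alternant N [] = (\<Sum>c\<in>?S (Suc b). ?V c (a + b - c))"
  proof -
    have "elem_mpoly N b * elem_mpoly N a * alternant N [] = elem_mpoly N b * ?V 0 a"
      using assms by (simp add: elem_mpoly_mult_empty mult.assoc)
    then show ?thesis
      using assms by (simp add: elem_mpoly_mult_column) (intro sum.cong, auto)
  qed
  have 2: "(if b = 0 then 0 else elem_mpoly N (b - 1) * elem_mpoly N (a + 1)) * alternant N []
      = (\<Sum>c\<in>?S b. ?V c (a + b - c))"
  \<comment> \<open>For \<open>a = N\<close> the factor of degree \<open>N + 1\<close> is zero, and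
    no \<open>c < b\<close> satisfies \<open>a + b - c \<le> N\<close>.\<close>
  proof (cases "b = 0 \<or> a = N")
    case True
    then show ?thesis using assms by (auto simp: elem_mpoly_eq_0 intro!: sum.neutral)
  next
    case False
    then have "elem_mpoly N (b - 1) * elem_mpoly N (a + 1) * alternant N [] =
        elem_mpoly N (b - 1) * ?V 0 (a + 1)"
      using assms by (simp add: elem_mpoly_mult_empty mult.assoc)
    also have "\<dots> = (\<Sum>c\<in>?S b. ?V c (a + b - c))"
      using assms False by (simp add: elem_mpoly_mult_column) (intro sum.cong, auto)
    finally show ?thesis using False by simp
  qed
  have "?S (Suc b) = insert b (?S b)" using assms by auto
  then have "(\<Sum>c\<in>?S (Suc b). ?V c (a + b - c)) = ?V b a + (\<Sum>c\<in>?S b. ?V c (a + b - c))"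
    using assms by (subst \<open>?S (Suc b) = _\<close>, subst sum.insert) auto
  then show ?thesis using 1 2 by (simp add: left_diff_distrib)
qed

text \<open>Cancelling the nonzero denominator gives the uniqueness that \<open>THE\<close>
  requires. With fewer than \<open>m + k\<close> variables both products vanish, in agreement with
  the convention.\<close>

lemma schur_two_columns:
  "schur (replicate m 2 @ replicate k 1) ys =
     eval_mpoly (\<lambda>i. ys ! i) (elem_mpoly (length ys) m * elem_mpoly (length ys) (m + k)
      - (if m = 0 then 0 else elem_mpoly (length ys) (m - 1) * elem_mpoly (length ys) (m + k + 1)))"
  (is "_ = eval_mpoly _ ?p")
proof -
  let ?N = "length ys" and ?\<mu> = "replicate m (2::nat) @ replicate k 1"
  have len: "length (filter (\<lambda>p. p \<noteq> 0) ?\<mu>) = m + k" by simp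
  have "schur_poly ?N ?\<mu> = ?p"
  proof (cases "?N < m + k")
    case True
    then show ?thesis
      by (simp add: schur_poly_def elem_mpoly_eq_0)
  next
    case False
    have "alternant ?N ?\<mu> = two_column_alternant ?N m (m + k)"
      unfolding alternant_def two_column_alternant_def gen_alternant_def
      by (intro arg_cong[where f="Determinant.det"] cong_mat)
         (auto simp: part_def nth_append)
    then have eq: "?p * alternant ?N [] = alternant ?N ?\<mu>"
      using two_column_schur_numerator[of m "m + k" ?N] False by simp
    then have "(THE p. p * alternant ?N [] = alternant ?N ?\<mu>) = ?p"
      using alternant_empty_nonzero[of ?N]
      by (intro the_equality) (assumption, metis mult_right_cancel)
    then show ?thesis using False unfolding schur_poly_def len by simp
  qed
  then show ?thesis by (simp add: schur_def)
qed

section \<open>A single species on the ring\<close>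

definition ring_dist :: "nat \<Rightarrow> nat \<Rightarrow> nat \<Rightarrow> nat" where
  "ring_dist n r s = (if r \<le> s then s - r else n + s - r)"

definition pred_site :: "nat \<Rightarrow> nat \<Rightarrow> nat" where
  "pred_site n s = (if s = 1 then n else s - 1)"

text \<open>The search includes the starting site, at distance 0.\<close>

definition first_in :: "nat \<Rightarrow> nat set \<Rightarrow> nat \<Rightarrow> nat" where
  "first_in n U r = arg_min (ring_dist n r) (\<lambda>u. u \<in> U)"

text \<open>Indicator of the clockwise arc from \<open>r\<close> up to, but excluding,
  \<open>u\<close>: the sites after which a customer arriving at \<open>r\<close> and served at
  \<open>u\<close> is still waiting. It is an integer so that it can be added to and subtracted from
  queue lengths.\<close>

definition arc :: "nat \<Rightarrow> nat \<Rightarrow> nat \<Rightarrow> nat \<Rightarrow> int" where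
  "arc n r u s = of_bool (ring_dist n r s < ring_dist n r u)"

definition landing :: "nat \<Rightarrow> nat set \<Rightarrow> nat \<Rightarrow> nat" where
  "landing n X j = first_in n ({1..n} - X) j"

text \<open>If \<open>j\<close> is vacant the landing site is \<open>j\<close> itself, and insertion
  and deletion cancel; a bell at a vacant site is thus covered.\<close>

definition jump :: "nat \<Rightarrow> nat \<Rightarrow> nat set \<Rightarrow> nat set" where
  "jump n j X = insert (landing n X j) X - {j}"

lemma ring_dist_less: "r \<in> {1..n} \<Longrightarrow> s \<in> {1..n} \<Longrightarrow> ring_dist n r s < n"
  by (auto simp: ring_dist_def)

lemma ring_dist_eq_iff:
  "r \<in> {1..n} \<Longrightarrow> s \<in> {1..n} \<Longrightarrow> t \<in> {1..n} \<Longrightarrow> ring_dist n r s = ring_dist n r t \<longleftrightarrow> s = t"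
  by (auto simp: ring_dist_def split: if_splits)

lemma ring_dist_self [simp]: "ring_dist n r r = 0"
  by (simp add: ring_dist_def)

lemma ring_dist_eq_0_iff: "r \<in> {1..n} \<Longrightarrow> s \<in> {1..n} \<Longrightarrow> ring_dist n r s = 0 \<longleftrightarrow> s = r"
  by (auto simp: ring_dist_def)

lemma ring_dist_pred:
  "r \<in> {1..n} \<Longrightarrow> s \<in> {1..n} \<Longrightarrow> s \<noteq> r \<Longrightarrow> ring_dist n r s = Suc (ring_dist n r (pred_site n s))"
  by (auto simp: ring_dist_def pred_site_def)

lemma ring_dist_triangle:
  assumes "r \<in> {1..n}" "s \<in> {1..n}" "t \<in> {1..n}" "ring_dist n r s \<le> ring_dist n r t"
  shows "ring_dist n s t = ring_dist n r t - ring_dist n r s"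
  using assms by (auto simp: ring_dist_def split: if_splits)

lemma pred_site_mem: "s \<in> {1..n} \<Longrightarrow> pred_site n s \<in> {1..n}"
  by (auto simp: pred_site_def)

lemma clockwise_ring_dist:
  assumes "r \<in> {1..n}" "s \<in> {1..n}"
  shows "clockwise n r (ring_dist n r s) = s"
proof (cases "r \<le> s")
  case True
  then have "r - 1 + ring_dist n r s = s - 1" "s - 1 < n" using assms by (auto simp: ring_dist_def)
  then show ?thesis using assms by (simp add: clockwise_def)
next
  case False
  then have "r - 1 + ring_dist n r s = s - 1 + n" "s - 1 < n" using assms by (auto simp: ring_dist_def)
  then have "(r - 1 + ring_dist n r s) mod n = s - 1" by (simp only: mod_add_self2 mod_less)
  then show ?thesis using assms by (simp add: clockwise_def)
qed

lemma ring_dist_clockwise: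
  assumes "r \<in> {1..n}" "d < n"
  shows "ring_dist n r (clockwise n r d) = d"
proof (cases "r - 1 + d < n")
  case True
  then show ?thesis using assms by (simp add: ring_dist_def clockwise_def)
next
  case False
  then have "r - 1 + d = (r - 1 + d - n) + n" "r - 1 + d - n < n" using assms by auto
  then have "(r - 1 + d) mod n = r - 1 + d - n" by (metis mod_add_self2 mod_less)
  then show ?thesis using assms False by (simp add: ring_dist_def clockwise_def)
qed

lemma clockwise_mem: "0 < n \<Longrightarrow> clockwise n r d \<in> {1..n}"
  by (simp add: clockwise_def Suc_leI)

lemma first_in_mem: "U \<noteq> {} \<Longrightarrow> first_in n U r \<in> U"
  unfolding first_in_def by (metis arg_min_natI ex_in_conv)

lemma first_in_le: "v \<in> U \<Longrightarrow> ring_dist n r (first_in n U r) \<le> ring_dist n r v"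
  unfolding first_in_def by (rule arg_min_nat_le)

lemma first_in_eqI:
  assumes "U \<subseteq> {1..n}" "r \<in> {1..n}" "u \<in> U" "\<And>v. v \<in> U \<Longrightarrow> ring_dist n r u \<le> ring_dist n r v"
  shows "first_in n U r = u"
proof -
  have "U \<noteq> {}" using assms by blast
  then have "ring_dist n r (first_in n U r) = ring_dist n r u" "first_in n U r \<in> U"
    using first_in_mem[of U n r] first_in_le[of _ U n r] assms by (auto intro!: antisym)
  then show ?thesis using assms ring_dist_eq_iff by blast
qed

lemma first_in_self: "U \<subseteq> {1..n} \<Longrightarrow> r \<in> {1..n} \<Longrightarrow> r \<in> U \<Longrightarrow> first_in n U r = r"
  by (rule first_in_eqI) auto

text \<open>The discrete derivative of an arc has a source at \<open>r\<close> and a sink at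
  \<open>u\<close>: it is the balance equation of a single customer. Both sides vanish everywhere
  when \<open>u = r\<close>.\<close>

lemma arc_step:
  assumes "r \<in> {1..n}" "u \<in> {1..n}" "s \<in> {1..n}"
  shows "arc n r u s - arc n r u (pred_site n s) = of_bool (s = r) - of_bool (s = u)"
proof (cases "s = r")
  case True
  then have "ring_dist n r (pred_site n s) = n - 1"
    using assms by (auto simp: ring_dist_def pred_site_def)
  then show ?thesis
    using True assms ring_dist_less[of r n u] ring_dist_eq_0_iff[of r n u]
    by (auto simp: arc_def)
next
  case False
  then show ?thesis
    using assms ring_dist_pred[of r n s] ring_dist_eq_iff[of r n s u] by (auto simp: arc_def)
qed

lemma arc_nonneg: "0 \<le> arc n r u s"
  by (simp add: arc_def)

lemma arc_end [simp]: "arc n r u u = 0"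
  by (simp add: arc_def)

lemma arc_first_in: "arc n r (first_in n U r) s \<noteq> 0 \<Longrightarrow> s \<notin> U"
  using first_in_le[of s U n r] by (auto simp: arc_def)

lemma landing:
  assumes "X \<subseteq> {1..n}" "X \<noteq> {1..n}"
  shows "landing n X j \<in> {1..n}" "landing n X j \<notin> X"
    "arc n j (landing n X j) s \<noteq> 0 \<Longrightarrow> s \<in> {1..n} \<Longrightarrow> s \<in> X"
proof -
  have ne: "{1..n} - X \<noteq> {}" using assms by blast
  show "landing n X j \<in> {1..n}" "landing n X j \<notin> X"
    using first_in_mem[OF ne] unfolding landing_def by blast+
  show "arc n j (landing n X j) s \<noteq> 0 \<Longrightarrow> s \<in> {1..n} \<Longrightarrow> s \<in> X"
    using arc_first_in unfolding landing_def by blast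
qed

lemma landing_self: "X \<subseteq> {1..n} \<Longrightarrow> j \<in> {1..n} \<Longrightarrow> j \<notin> X \<Longrightarrow> landing n X j = j"
  unfolding landing_def by (rule first_in_self) auto

lemma jump_not_mem: "X \<subseteq> {1..n} \<Longrightarrow> j \<in> {1..n} \<Longrightarrow> j \<notin> X \<Longrightarrow> jump n j X = X"
  by (auto simp: jump_def landing_self)

lemma jump_subset: "X \<subseteq> {1..n} \<Longrightarrow> X \<noteq> {1..n} \<Longrightarrow> jump n j X \<subseteq> {1..n}"
  using landing(1)[of X n j] by (auto simp: jump_def)

lemma card_jump:
  assumes "X \<subseteq> {1..n}" "X \<noteq> {1..n}" "j \<in> {1..n}"
  shows "card (jump n j X) = card X"
proof (cases "j \<in> X")
  case True
  have "finite X" using assms finite_subset by blast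
  then show ?thesis using True landing(2)[OF assms(1,2), of j] by (simp add: jump_def)
next
  case False
  then show ?thesis using jump_not_mem[OF assms(1,3)] by simp
qed

section \<open>Projection to one species\<close>

definition level :: "nat \<Rightarrow> nat \<Rightarrow> (nat \<Rightarrow> nat) \<Rightarrow> nat set" where
  "level n t \<eta> = {s \<in> {1..n}. t \<le> \<eta> s}"

text \<open>\<open>first_below\<close> starts one step ahead while \<open>first_in\<close> starts at
  \<open>k\<close>; the hypothesis \<open>r \<le> \<eta> k\<close> keeps \<open>k\<close> itself
  from being found.\<close>

lemma first_below_eq:
  assumes "k \<in> {1..n}" "r \<le> \<eta> k" "v \<in> {1..n}" "\<eta> v < r"
  shows "first_below n \<eta> k r = first_in n {s \<in> {1..n}. \<eta> s < r} k"
proof -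
  let ?U = "{s \<in> {1..n}. \<eta> s < r}" and ?u = "first_in n {s \<in> {1..n}. \<eta> s < r} k"
  have "?U \<noteq> {}" using assms by blast
  note u = first_in_mem[OF this, of n k] first_in_le[of _ ?U n k]
  have u1: "?u \<in> {1..n}" "\<eta> ?u < r" using u(1) by auto
  have "(LEAST d. 1 \<le> d \<and> \<eta> (clockwise n k d) < r) = ring_dist n k ?u"
  proof (rule Least_equality)
    have "?u \<noteq> k" using u1 assms by auto
    then have "ring_dist n k ?u \<noteq> 0" using ring_dist_eq_0_iff assms(1) u1(1) by blast
    then show "1 \<le> ring_dist n k ?u \<and> \<eta> (clockwise n k (ring_dist n k ?u)) < r"
      using u1 assms by (simp add: clockwise_ring_dist)
  next
    fix d assume d: "1 \<le> d \<and> \<eta> (clockwise n k d) < r"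
    show "ring_dist n k ?u \<le> d"
    proof (cases "d < n")
      case True
      then have "clockwise n k d \<in> ?U" using d clockwise_mem[of n k d] by simp
      then show ?thesis using u(2) ring_dist_clockwise[OF assms(1) True] by metis
    next
      case False
      then show ?thesis using ring_dist_less[OF assms(1) u1(1)] by simp
    qed
  qed
  then show ?thesis
    using clockwise_ring_dist[OF assms(1) u1(1)] by (simp add: first_below_def)
qed

lemma push_0: "push n k 0 \<eta> = \<eta>"
  by (subst push.simps) simp

lemma push_step:
  assumes "k \<in> {1..n}" "r \<le> \<eta> k" "v \<in> {1..n}" "\<eta> v = 0" "0 < r"
    and k': "k' = first_in n {s \<in> {1..n}. \<eta> s < r} k"
  shows "push n k r \<eta> = push n k' (\<eta> k') (\<eta>(k' := r))"
    and "k' \<in> {1..n}" "\<eta> k' < r"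
    and "\<And>s. s \<in> {1..n} \<Longrightarrow> \<eta> s < r \<Longrightarrow> ring_dist n k k' \<le> ring_dist n k s"
proof -
  have ne: "{s \<in> {1..n}. \<eta> s < r} \<noteq> {}" using assms by auto
  have "first_below n \<eta> k r = k'"
    using first_below_eq[of k n r \<eta> v] assms by simp
  moreover show "k' \<in> {1..n}" "\<eta> k' < r" using first_in_mem[OF ne, of n k] k' by auto
  ultimately show "push n k r \<eta> = push n k' (\<eta> k') (\<eta>(k' := r))"
    using \<open>0 < r\<close> by (subst push.simps) (simp add: Let_def)
  show "\<And>s. s \<in> {1..n} \<Longrightarrow> \<eta> s < r \<Longrightarrow> ring_dist n k k' \<le> ring_dist n k s"
    using first_in_le[of _ "{s \<in> {1..n}. \<eta> s < r}" n k] k' by auto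
qed

text \<open>Only one move of the cascade is visible at threshold \<open>t\<close>: the one in which
  a species at least \<open>t\<close> displaces a species below \<open>t\<close>. Earlier moves
  exchange two species of the level, later ones involve none.\<close>

lemma level_push:
  assumes "k \<in> {1..n}" "r \<le> \<eta> k" "r = 0 \<or> (\<exists>v \<in> {1..n}. \<eta> v = 0)" "0 < t"
  shows "level n t (push n k r \<eta>) =
    (if t \<le> r then insert (landing n (level n t \<eta>) k) (level n t \<eta>) else level n t \<eta>)"
  using assms
proof (induction r arbitrary: k \<eta> rule: less_induct)
  case (less r)
  show ?case
  proof (cases "r = 0")
    case True
    then show ?thesis using less.prems by (simp add: push_0)
  next
    case False
    then obtain v where v: "v \<in> {1..n}" "\<eta> v = 0" using less.prems by blast
    define k' where "k' = first_in n {s \<in> {1..n}. \<eta> s < r} k"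
    have "0 < r" using False by simp
    note step = push_step[OF less.prems(1,2) v this k'_def]
    let ?\<eta> = "\<eta>(k' := r)"
    \<comment> \<open>The move may have filled the only vacancy. The cascade then ends, and for this
      the induction admits \<open>r = 0\<close> without any vacancy.\<close>
    have "\<eta> k' = 0 \<or> (\<exists>v \<in> {1..n}. ?\<eta> v = 0)" using v by (cases "v = k'") auto
    then have IH: "level n t (push n k' (\<eta> k') ?\<eta>) =
        (if t \<le> \<eta> k' then insert (landing n (level n t ?\<eta>) k') (level n t ?\<eta>) else level n t ?\<eta>)"
      using step(2,3) less.prems(4) by (intro less.IH) auto
    have lev: "level n t ?\<eta> = (if t \<le> r then insert k' (level n t \<eta>) else level n t \<eta>)"
      using step(2,3) by (auto simp: level_def)
    consider "r < t" | "t \<le> r" "\<eta> k' < t" | "t \<le> r" "t \<le> \<eta> k'" by linarith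
    then show ?thesis
    proof cases
      case 1
      then show ?thesis using IH lev step(1,3) by simp
    next
      case 2
      then have "landing n (level n t \<eta>) k = k'"
        unfolding landing_def using step(2,4) less.prems(1)
        by (intro first_in_eqI) (auto simp: level_def)
      then show ?thesis using 2 IH lev step(1) by simp
    next
      case 3
      \<comment> \<open>No site outside the level precedes \<open>k'\<close> as seen from
        \<open>k\<close>, so the searches from \<open>k\<close> and from \<open>k'\<close> find the
        same site.\<close>
      let ?C = "{1..n} - level n t \<eta>"
      have ne: "?C \<noteq> {}" using v \<open>0 < t\<close> by (auto simp: level_def)
      let ?u = "first_in n ?C k"
      have u: "?u \<in> ?C" using first_in_mem[OF ne] .
      have less: "ring_dist n k k' \<le> ring_dist n k s" if "s \<in> ?C" for s
        using that 3 by (intro step(4)) (auto simp: level_def)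
      have "first_in n ?C k' = ?u"
      proof (rule first_in_eqI)
        fix s assume s: "s \<in> ?C"
        show "ring_dist n k' ?u \<le> ring_dist n k' s"
          using ring_dist_triangle[OF less.prems(1) step(2), of s]
            ring_dist_triangle[OF less.prems(1) step(2), of ?u]
            less[OF s] less[OF u] u s first_in_le[OF s, of n k] by simp
      qed (use u step(2) in auto)
      then have "landing n (level n t \<eta>) k' = landing n (level n t \<eta>) k"
        by (simp add: landing_def)
      moreover have "insert k' (level n t \<eta>) = level n t \<eta>"
        using 3 step(2) by (auto simp: level_def)
      ultimately show ?thesis using 3 IH lev step(1) by simp
    qed
  qed
qed

lemma level_ring_bell:
  assumes "\<eta> \<in> configs n" "j \<in> {1..n}" "0 < t"
  shows "level n t (ring_bell n j \<eta>) = jump n j (level n t \<eta>)"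
proof (cases "\<eta> j = 0")
  case True
  then show ?thesis
    using assms by (subst jump_not_mem) (auto simp: ring_bell_def level_def)
next
  case False
  have "0 \<in> \<eta> ` {1..n}"
    using assms by (auto simp: configs_def bij_betw_def)
  then have "\<eta> j = 0 \<or> (\<exists>v \<in> {1..n}. \<eta> v = 0)" by auto
  note push = level_push[OF assms(2) order_refl this \<open>0 < t\<close>]
  have "level n t (ring_bell n j \<eta>) = level n t (push n j (\<eta> j) \<eta>) - {j}"
    using False \<open>0 < t\<close> by (auto simp: ring_bell_def level_def)
  show ?thesis
  proof (cases "t \<le> \<eta> j")
    case True
    then show ?thesis using push \<open>level n t (ring_bell n j \<eta>) = _\<close> by (simp add: jump_def)
  next
    case False
    then have "j \<notin> level n t \<eta>" by (simp add: level_def)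
    moreover have "level n t \<eta> \<subseteq> {1..n}" by (auto simp: level_def)
    ultimately show ?thesis
      using push False \<open>level n t (ring_bell n j \<eta>) = _\<close> jump_not_mem[OF _ assms(2)] by simp
  qed
qed

lemma extensional_push: "\<eta> \<in> extensional {1..n} \<Longrightarrow> 0 < n \<Longrightarrow> push n k r \<eta> \<in> extensional {1..n}"
proof (induction n k r \<eta> rule: push.induct)
  case (1 n k r \<eta>)
  let ?k = "first_below n \<eta> k r"
  show ?case
  proof (cases "r = 0 \<or> \<not> \<eta> ?k < r")
    case True
    then show ?thesis using 1 by (subst push.simps) (simp add: Let_def)
  next
    case False
    have "?k \<in> {1..n}" using 1 unfolding first_below_def by (intro clockwise_mem)
    then have "\<eta>(?k := r) \<in> extensional {1..n}"
      using 1 by (auto simp: extensional_def)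
    then have "push n ?k (\<eta> ?k) (\<eta>(?k := r)) \<in> extensional {1..n}"
      using 1 False by blast
    then show ?thesis using False by (subst push.simps) (simp add: Let_def)
  qed
qed

lemma card_level:
  assumes "\<eta> \<in> configs n" "t \<le> n"
  shows "card (level n t \<eta>) = n - t"
proof -
  have bij: "bij_betw \<eta> {1..n} {0..<n}" using assms by (simp add: configs_def)
  have "\<eta> ` level n t \<eta> = \<eta> ` {1..n} \<inter> {t..}" by (auto simp: level_def)
  also have "\<dots> = {t..<n}" using bij_betw_imp_surj_on[OF bij] by auto
  finally have "bij_betw \<eta> (level n t \<eta>) {t..<n}"
    using bij_betw_imp_inj_on[OF bij] by (auto simp: bij_betw_def level_def intro: inj_on_subset)
  then show ?thesis by (simp add: bij_betw_same_card)
qed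

text \<open>Level sizes characterise the permutations, so that a bell is seen to preserve
  \<open>configs\<close> from \<open>card_jump\<close> alone, without following the cascade.\<close>

lemma configs_iff_card_level:
  "\<eta> \<in> configs n \<longleftrightarrow> \<eta> \<in> extensional {1..n} \<and> (\<forall>t. card (level n t \<eta>) = n - t)"
proof safe
  fix t assume \<eta>: "\<eta> \<in> configs n"
  show "card (level n t \<eta>) = n - t"
  proof (cases "t \<le> n")
    case False
    have "\<eta> s < n" if "s \<in> {1..n}" for s
      using \<eta> that by (auto simp: configs_def bij_betw_def)
    then have "level n t \<eta> = {}" using False by (fastforce simp: level_def)
    then show ?thesis using False by simp
  qed (rule card_level[OF \<eta>])
next
  assume ext: "\<eta> \<in> extensional {1..n}" and card: "\<forall>t. card (level n t \<eta>) = n - t"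
  have fin: "finite (level n t \<eta>)" for t by (simp add: level_def)
  have lt: "\<eta> s < n" if "s \<in> {1..n}" for s
  proof (rule ccontr)
    assume "\<not> \<eta> s < n"
    then have "s \<in> level n n \<eta>" using that by (simp add: level_def)
    then show False using card fin[of n] by (metis card_0_eq diff_self_eq_0 empty_iff)
  qed
  have ex: "\<exists>s\<in>{1..n}. \<eta> s = t" if "t < n" for t
  proof (rule ccontr)
    assume "\<not> ?thesis"
    then have "t \<le> \<eta> s \<longleftrightarrow> Suc t \<le> \<eta> s" if "s \<in> {1..n}" for s
      using that by (metis Suc_leD Suc_leI order_le_less)
    then have "level n t \<eta> = level n (Suc t) \<eta>" unfolding level_def by blast
    then have "n - t = n - Suc t" using card by metis
    then show False using that by simp
  qed
  have "{0..<n} \<subseteq> \<eta> ` {1..n}"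
  proof
    fix t assume "t \<in> {0..<n}"
    then show "t \<in> \<eta> ` {1..n}" using ex[of t] by auto
  qed
  moreover have "\<eta> ` {1..n} \<subseteq> {0..<n}" using lt by auto
  ultimately have "\<eta> ` {1..n} = {0..<n}" by (rule subset_antisym[rotated])
  then have "bij_betw \<eta> {1..n} {0..<n}"
    by (intro bij_betw_imageI eq_card_imp_inj_on) auto
  then show "\<eta> \<in> configs n" using ext by (simp add: configs_def)
qed (simp add: configs_def)

lemma finite_level: "finite (level n t \<eta>)"
  by (simp add: level_def)

lemma level_0: "level n 0 \<eta> = {1..n}"
  by (auto simp: level_def)

lemma level_n: "\<eta> \<in> configs n \<Longrightarrow> level n n \<eta> = {}"
  using card_level[of \<eta> n n] finite_level[of n n \<eta>] by simp

lemma level_proper: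
  assumes "\<eta> \<in> configs n" "0 < n" "0 < t"
  shows "level n t \<eta> \<subseteq> {1..n}" "level n t \<eta> \<noteq> {1..n}"
proof -
  show "level n t \<eta> \<subseteq> {1..n}" by (auto simp: level_def)
  have "card (level n t \<eta>) < n" using assms configs_iff_card_level[of \<eta> n] by simp
  then show "level n t \<eta> \<noteq> {1..n}" by auto
qed

lemma ring_bell_configs:
  assumes "\<eta> \<in> configs n" "j \<in> {1..n}"
  shows "ring_bell n j \<eta> \<in> configs n"
  unfolding configs_iff_card_level
proof (intro conjI allI)
  have "0 < n" using assms by simp
  then show "ring_bell n j \<eta> \<in> extensional {1..n}"
    using assms extensional_push[of \<eta> n j "\<eta> j"]
    by (auto simp: ring_bell_def configs_def extensional_def)
  fix t
  show "card (level n t (ring_bell n j \<eta>)) = n - t"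
  proof (cases "t = 0")
    case True
    then show ?thesis by (simp add: level_0)
  next
    case False
    then show ?thesis
      using assms level_ring_bell[of \<eta> n j t] level_proper[of \<eta> n t] configs_iff_card_level[of \<eta> n]
      by (simp add: card_jump)
  qed
qed

section \<open>Two-line queues\<close>

text \<open>Induction once around the ring, which is cut at \<open>u\<close>: the step never passes
  from the predecessor of \<open>u\<close> back to \<open>u\<close>.\<close>

lemma ring_induct [consumes 2, case_names start step]:
  assumes "u \<in> {1..n}" "s \<in> {1..n}" and start: "P u"
    and step: "\<And>s. s \<in> {1..n} \<Longrightarrow> s \<noteq> u \<Longrightarrow> P (pred_site n s) \<Longrightarrow> P s"
  shows "P s"
  using assms(2)
proof (induction "ring_dist n u s" arbitrary: s)
  case 0
  then show ?case using assms(1) start ring_dist_eq_0_iff by metis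
next
  case (Suc d)
  then have "s \<noteq> u" by auto
  then have "d = ring_dist n u (pred_site n s)"
    using Suc.hyps(2) ring_dist_pred[OF assms(1) Suc.prems] by simp
  then show ?case using Suc.hyps(1) Suc.prems \<open>s \<noteq> u\<close> pred_site_mem step by blast
qed

lemma bij_betw_pred_site: "bij_betw (pred_site n) {1..n} {1..n}"
proof (intro bij_betw_imageI eq_card_imp_inj_on)
  show "pred_site n ` {1..n} = {1..n}"
  proof (intro subset_antisym subsetI)
    fix s assume s: "s \<in> {1..n}"
    show "s \<in> pred_site n ` {1..n}"
    proof (cases "s = n")
      case True
      then show ?thesis using s by (intro image_eqI[of _ _ 1]) (auto simp: pred_site_def)
    next
      case False
      then show ?thesis using s by (intro image_eqI[of _ _ "Suc s"]) (auto simp: pred_site_def)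
    qed
  qed (use pred_site_mem in blast)
  then show "card (pred_site n ` {1..n}) = card {1..n}" by simp
qed simp

text \<open>
  A two-line queue: at every site of \<open>R\<close> a customer arrives, at every site of \<open>B\<close> one customer can be
  served, \<open>A\<close> is the set of sites where a service takes place, and \<open>c s\<close> customers are left waiting
  after site \<open>s\<close>.
\<close>

definition is_queue ::
  "nat \<Rightarrow> nat set \<Rightarrow> nat set \<Rightarrow> nat set \<Rightarrow> (nat \<Rightarrow> int) \<Rightarrow> bool" where
  "is_queue n R B A c \<longleftrightarrow> A \<subseteq> B \<and> (\<forall>s\<in>{1..n}. 0 \<le> c s
     \<and> c s = c (pred_site n s) + of_bool (s \<in> R) - of_bool (s \<in> A) \<and> (s \<in> B - A \<longrightarrow> c s = 0))"

lemma is_queueD: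
  assumes "is_queue n R B A c"
  shows "A \<subseteq> B" "s \<in> {1..n} \<Longrightarrow> 0 \<le> c s"
    "s \<in> {1..n} \<Longrightarrow> c s = c (pred_site n s) + of_bool (s \<in> R) - of_bool (s \<in> A)"
    "s \<in> {1..n} \<Longrightarrow> s \<in> B \<Longrightarrow> s \<notin> A \<Longrightarrow> c s = 0"
  using assms unfolding is_queue_def by blast+

text \<open>Summed around the ring, the queue lengths in the balance equations cancel.\<close>

lemma is_queue_card:
  assumes "is_queue n R B A c" "R \<subseteq> {1..n}" "B \<subseteq> {1..n}"
  shows "card A = card R"
proof -
  have "A \<subseteq> {1..n}" using is_queueD(1)[OF assms(1)] assms(3) by blast
  have "(\<Sum>s\<in>{1..n}. c s) = (\<Sum>s\<in>{1..n}. c (pred_site n s) + of_bool (s \<in> R) - of_bool (s \<in> A))"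
    by (intro sum.cong refl is_queueD(3)[OF assms(1)])
  also have "\<dots> = (\<Sum>s\<in>{1..n}. c (pred_site n s)) + card ({1..n} \<inter> R) - card ({1..n} \<inter> A)"
    by (simp add: sum.distrib sum_subtractf)
  also have "(\<Sum>s\<in>{1..n}. c (pred_site n s)) = (\<Sum>s\<in>{1..n}. c s)"
    by (rule sum.reindex_bij_betw[OF bij_betw_pred_site])
  finally show ?thesis using assms \<open>A \<subseteq> {1..n}\<close> by (simp add: inf_absorb2)
qed

lemma is_queue_free:
  assumes "is_queue n R B A c" "R \<subseteq> {1..n}" "B \<subseteq> {1..n}" "card R < card B"
  obtains u where "u \<in> {1..n}" "u \<in> B" "u \<notin> A"
proof -
  have "A \<noteq> B" using is_queue_card[OF assms(1-3)] assms(4) by auto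
  then show ?thesis using that is_queueD(1)[OF assms(1)] assms(3) by blast
qed

lemma is_queue_mono:
  assumes "is_queue n R B A c" "is_queue n R B A' c'" "u \<in> {1..n}" "u \<in> B" "u \<notin> A" "s \<in> {1..n}"
  shows "c s \<le> c' s"
  using assms(3,6)
proof (induction rule: ring_induct)
  case start
  then show ?case
    using is_queueD(4)[OF assms(1,3,4,5)] is_queueD(2)[OF assms(2,3)] by simp
next
  case (step s)
  show ?case
    using step(3) is_queueD(1)[OF assms(1)] is_queueD(1)[OF assms(2)]
      is_queueD(2-4)[OF assms(1) step(1)] is_queueD(2-4)[OF assms(2) step(1)]
    by (cases "s \<in> A"; cases "s \<in> A'"; cases "s \<in> R"; cases "s \<in> B") auto
qed

lemma is_queue_unique:
  assumes "is_queue n R B A c" "is_queue n R B A' c'" "R \<subseteq> {1..n}" "B \<subseteq> {1..n}" "card R < card B"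
  shows "A = A'"
proof -
  obtain u where u: "u \<in> {1..n}" "u \<in> B" "u \<notin> A"
    using is_queue_free[OF assms(1,3,4,5)] .
  obtain u' where u': "u' \<in> {1..n}" "u' \<in> B" "u' \<notin> A'"
    using is_queue_free[OF assms(2,3,4,5)] .
  have eq: "c s = c' s" if "s \<in> {1..n}" for s
    using is_queue_mono[OF assms(1,2) u that] is_queue_mono[OF assms(2,1) u' that] by simp
  have "s \<in> A \<longleftrightarrow> s \<in> A'" if "s \<in> {1..n}" for s
    using is_queueD(3)[OF assms(1) that] is_queueD(3)[OF assms(2) that] eq[OF that]
      eq[OF pred_site_mem[OF that]] by (auto split: if_splits simp: of_bool_def)
  then show ?thesis
    using is_queueD(1)[OF assms(1)] is_queueD(1)[OF assms(2)] assms(4) by blast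
qed

lemma is_queue_exists:
  assumes "R \<subseteq> {1..n}" "B \<subseteq> {1..n}" "card R \<le> card B"
  shows "\<exists>A c. is_queue n R B A c"
proof -
  have "finite R" using assms(1) finite_subset by blast
  then show ?thesis using assms
  proof (induction R rule: finite_induct)
    case empty
    have "is_queue n {} B {} (\<lambda>s. 0)" by (simp add: is_queue_def)
    then show ?case by blast
  next
    case (insert r R)
    then obtain A c where q: "is_queue n R B A c" by auto
    have "card R < card B" using insert by simp
    then obtain u0 where "u0 \<in> B - A"
      using is_queue_free[OF q, of thesis] insert.prems by auto
    define u where "u = first_in n (B - A) r"
    have u: "u \<in> B" "u \<notin> A"
      using first_in_mem[of "B - A" n r] \<open>u0 \<in> B - A\<close> by (auto simp: u_def)
    have mem: "r \<in> {1..n}" "u \<in> {1..n}" using u insert.prems by auto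
    have "is_queue n (insert r R) B (insert u A) (\<lambda>s. c s + arc n r u s)"
      unfolding is_queue_def
    proof (intro conjI ballI impI)
      show "insert u A \<subseteq> B" using u is_queueD(1)[OF q] by blast
    next
      fix s assume s: "s \<in> {1..n}"
      show "0 \<le> c s + arc n r u s" using is_queueD(2)[OF q s] arc_nonneg[of n r u s] by simp
      show "c s + arc n r u s = c (pred_site n s) + arc n r u (pred_site n s)
          + of_bool (s \<in> insert r R) - of_bool (s \<in> insert u A)"
        using is_queueD(3)[OF q s] arc_step[OF mem s] u(2) insert.hyps(2)
        by (auto simp: of_bool_def split: if_splits)
      assume "s \<in> B - insert u A"
      then have "s \<in> B" "s \<notin> A" by auto
      then have "c s = 0" "arc n r u s = 0"
        using is_queueD(4)[OF q s] arc_first_in[of n r "B - A" s] unfolding u_def by blast+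
      then show "c s + arc n r u s = 0" by simp
    qed
    then show ?case by blast
  qed
qed

lemma of_bool_jump:
  assumes "X \<subseteq> {1..n}" "X \<noteq> {1..n}" "j \<in> {1..n}"
  shows "(of_bool (s \<in> jump n j X) :: int) =
    of_bool (s \<in> X) + of_bool (s = landing n X j) - of_bool (s = j)"
  using landing(2)[OF assms(1,2), of j] landing_self[OF assms(1,3)]
  by (cases "j \<in> X") (auto simp: jump_def)

lemma arc_start: "r \<in> {1..n} \<Longrightarrow> u \<in> {1..n} \<Longrightarrow> arc n r u r = of_bool (u \<noteq> r)"
  using ring_dist_eq_0_iff[of r n u] by (auto simp: arc_def)

text \<open>
  The bell at \<open>j\<close> first rings in the service line; the bell of the site where the displaced service
  lands then rings in the arrival line. This moves the departures as the bell at \<open>j\<close> would.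
\<close>

lemma is_queue_jump:
  assumes q: "is_queue n R B A c" and R: "R \<subseteq> {1..n}" "R \<noteq> {1..n}"
    and B: "B \<subseteq> {1..n}" "B \<noteq> {1..n}" and j: "j \<in> {1..n}"
  defines "k \<equiv> landing n B j" and "j' \<equiv> landing n A j"
  defines "l \<equiv> landing n R k"
  shows "is_queue n (jump n k R) (jump n j B) (jump n j A) (\<lambda>s. c s + arc n j j' s - arc n k l s)"
proof -
  note qD = is_queueD[OF q]
  have A: "A \<subseteq> {1..n}" "A \<noteq> {1..n}" using qD(1) B by blast+
  have mem: "k \<in> {1..n}" "j' \<in> {1..n}" "l \<in> {1..n}"
    unfolding k_def j'_def l_def using landing(1) A B R by blast+
  have k: "k \<notin> B" unfolding k_def by (rule landing(2)[OF B])
  have j': "j' \<notin> A" unfolding j'_def by (rule landing(2)[OF A])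
  have "ring_dist n j j' \<le> ring_dist n j k"
    unfolding j'_def landing_def using k mem qD(1) by (intro first_in_le) auto
  then have less: "ring_dist n j j' < ring_dist n j k" if "j' \<noteq> k"
    using that ring_dist_eq_iff[OF j mem(2,1)] by simp
  have in_B: "s \<in> B" if "s \<in> {1..n}" "ring_dist n j s < ring_dist n j k" for s
    using landing(3)[OF B, of j s] that by (simp add: arc_def k_def)
  \<comment> \<open>At \<open>k\<close> a customer arrives and no service is offered. Along the arc
    every site brings another arrival and serves at most one, so the queue cannot empty and the arc
    can be subtracted.\<close>
  have c_pos: "1 \<le> c s" if "s \<in> {1..n}" "arc n k l s \<noteq> 0" for s
    using mem(1) that
  proof (induction rule: ring_induct)
    case start
    then have "k \<in> R" using landing(3)[OF R, of k k] mem unfolding l_def by blast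
    moreover have "k \<notin> A" using k qD(1) by blast
    ultimately show ?case
      using qD(3)[OF mem(1)] qD(2)[OF pred_site_mem[OF mem(1)]] by simp
  next
    case (step s)
    have "arc n k l (pred_site n s) \<noteq> 0"
      using step ring_dist_pred[OF mem(1) step(1,2)] by (auto simp: arc_def split: if_splits)
    moreover have "s \<in> R" using step(1,4) landing(3)[OF R, of k s] unfolding l_def by blast
    ultimately show ?case using step(3) qD(3)[OF step(1)] by (simp add: of_bool_def)
  qed
  have c_zero: "c s = 0" if "j' \<noteq> k" "s \<in> {1..n}"
    "ring_dist n j j' \<le> ring_dist n j s" "ring_dist n j s < ring_dist n j k" for s
    using mem(2) that(2) that(3,4)
  proof (induction rule: ring_induct)
    case start
    then show ?case using qD(4)[OF mem(2)] j' in_B mem(2) by blast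
  next
    case (step s)
    have ne: "ring_dist n j s \<noteq> ring_dist n j j'"
      using step(1,2) ring_dist_eq_iff[OF j step(1) mem(2)] by simp
    then have "s \<noteq> j" using step(4) by auto
    then have "c (pred_site n s) = 0"
      using step ne ring_dist_pred[OF j step(1)] by auto
    moreover have "s \<in> B" using in_B step by blast
    ultimately show ?case
      using qD(2,3,4)[OF step(1)] by (cases "s \<in> A") (auto simp: of_bool_def split: if_splits)
  qed
  show ?thesis
    unfolding is_queue_def
  proof (intro conjI ballI impI)
    show "jump n j A \<subseteq> jump n j B"
      using qD(1) in_B[OF mem(2)] less unfolding jump_def k_def[symmetric] j'_def[symmetric] by blast
  next
    fix s assume s: "s \<in> {1..n}"
    have arc_le: "arc n k l s \<le> 1" by (simp add: arc_def)
    show "0 \<le> c s + arc n j j' s - arc n k l s"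
      using qD(2)[OF s] c_pos[OF s] arc_nonneg[of n j j' s] arc_le by fastforce
    show "c s + arc n j j' s - arc n k l s =
      c (pred_site n s) + arc n j j' (pred_site n s) - arc n k l (pred_site n s)
      + of_bool (s \<in> jump n k R) - of_bool (s \<in> jump n j A)"
      using qD(3)[OF s] arc_step[OF j mem(2) s] arc_step[OF mem(1,3) s]
        of_bool_jump[OF R mem(1), of s] of_bool_jump[OF A j, of s]
      unfolding j'_def[symmetric] l_def[symmetric] by simp
    assume sB: "s \<in> jump n j B - jump n j A"
    then have "s \<noteq> j" "s = k \<or> s \<in> B" "s \<noteq> j'" "s \<notin> A"
      unfolding jump_def k_def[symmetric] j'_def[symmetric] by auto
    show "c s + arc n j j' s - arc n k l s = 0"
    proof (cases "s = k")
      case True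
      have "j' \<noteq> k" using True \<open>s \<noteq> j'\<close> by simp
      have "k \<noteq> j" using True \<open>s \<noteq> j\<close> by simp
      have "ring_dist n j k = Suc (ring_dist n j (pred_site n k))"
        using ring_dist_pred[OF j mem(1) \<open>k \<noteq> j\<close>] .
      then have "c (pred_site n k) = 0"
        using less[OF \<open>j' \<noteq> k\<close>] pred_site_mem[OF mem(1)] by (intro c_zero[OF \<open>j' \<noteq> k\<close>]) auto
      then have "c k = of_bool (k \<in> R)"
        using qD(3)[OF mem(1)] True \<open>s \<notin> A\<close> by simp
      moreover have "arc n j j' k = 0" using less[OF \<open>j' \<noteq> k\<close>] by (simp add: arc_def)
      moreover have "arc n k l k = of_bool (k \<in> R)"
        using arc_start[OF mem(1,3)] landing(2)[OF R, of k] landing_self[OF R(1) mem(1)]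
        unfolding l_def[symmetric] by auto
      ultimately show ?thesis using True by simp
    next
      case False
      then have "c s = 0" using qD(4)[OF s] \<open>s = k \<or> s \<in> B\<close> \<open>s \<notin> A\<close> by blast
      moreover have "arc n j j' s = 0"
        using landing(3)[OF A, of j s] s \<open>s \<notin> A\<close> unfolding j'_def by blast
      moreover have "arc n k l s = 0" using c_pos[OF s] \<open>c s = 0\<close> by auto
      ultimately show ?thesis by simp
    qed
  qed
qed

definition departures :: "nat \<Rightarrow> nat set \<Rightarrow> nat set \<Rightarrow> nat set" where
  "departures n R B = (THE A. \<exists>c. is_queue n R B A c)"

lemma departures_eqI:
  assumes "is_queue n R B A c" "R \<subseteq> {1..n}" "B \<subseteq> {1..n}" "card R < card B"
  shows "departures n R B = A"
  unfolding departures_def using assms is_queue_unique by (intro the_equality) blast+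

lemma departures:
  assumes "R \<subseteq> {1..n}" "B \<subseteq> {1..n}" "card R < card B"
  shows "\<exists>c. is_queue n R B (departures n R B) c"
  using is_queue_exists[of R n B] departures_eqI[of n R B] assms by auto

lemma card_departures:
  "R \<subseteq> {1..n} \<Longrightarrow> B \<subseteq> {1..n} \<Longrightarrow> card R < card B \<Longrightarrow> card (departures n R B) = card R"
  using departures is_queue_card by blast

lemma departures_subset:
  "R \<subseteq> {1..n} \<Longrightarrow> B \<subseteq> {1..n} \<Longrightarrow> card R < card B \<Longrightarrow> departures n R B \<subseteq> B"
  using departures is_queueD(1) by blast

lemma departures_jump:
  assumes "R \<subseteq> {1..n}" "B \<subseteq> {1..n}" "B \<noteq> {1..n}" "card R < card B" "j \<in> {1..n}"
  shows "departures n (jump n (landing n B j) R) (jump n j B) = jump n j (departures n R B)"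
proof -
  have "card B \<le> n" using card_mono[OF _ assms(2)] by simp
  then have R: "R \<noteq> {1..n}" using assms(4) by auto
  obtain c where c: "is_queue n R B (departures n R B) c" using departures assms by blast
  have k: "landing n B j \<in> {1..n}" by (rule landing(1)[OF assms(2,3)])
  show ?thesis
    using jump_subset[OF assms(1) R] jump_subset[OF assms(2,3)] assms(4)
      card_jump[OF assms(1) R k] card_jump[OF assms(2,3,5)]
    by (intro departures_eqI[OF is_queue_jump[OF c assms(1) R assms(2,3,5)]]) simp_all
qed

section \<open>The product weight\<close>

text \<open>Weight times bell rate is preserved by a jump if the bell moves to the landing site;
  this is why that site takes the place of the bell in the bijection below.\<close>

lemma prod_jump:
  fixes x :: "nat \<Rightarrow> real"
  assumes "X \<subseteq> {1..n}" "X \<noteq> {1..n}" "j \<in> {1..n}" "\<And>k. k \<in> {1..n} \<Longrightarrow> 0 < x k"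
  shows "prod x (jump n j X) / x (landing n X j) = prod x X / x j"
proof (cases "j \<in> X")
  case True
  have "finite X" using assms finite_subset by blast
  let ?k = "landing n X j"
  have k: "?k \<in> {1..n}" "?k \<notin> X" using landing[OF assms(1,2)] by auto
  then have "jump n j X = insert ?k (X - {j})" using True by (auto simp: jump_def)
  moreover have "prod x X = x j * prod x (X - {j})" using True \<open>finite X\<close> by (rule prod.remove[rotated])
  ultimately show ?thesis using k assms(3,4) \<open>finite X\<close> by (simp add: less_imp_neq[symmetric])
next
  case False
  then show ?thesis using jump_not_mem[OF assms(1,3)] landing_self[OF assms(1,3)] by simp
qed

lemma ring_dist_between:
  assumes "i \<in> {1..n}" "j \<in> {1..n}" "k \<in> {1..n}" "i \<noteq> j" "k \<noteq> i" "k \<noteq> j"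
  shows "ring_dist n j i < ring_dist n j k \<or> ring_dist n i j < ring_dist n i k"
  using assms by (auto simp: ring_dist_def)

text \<open>If two particles from different sites reached the same landing site, one start would lie
  on the path of the other and be occupied in that configuration, although the remaining particles
  coincide.\<close>

lemma jump_inj:
  assumes "X \<subseteq> {1..n}" "X \<noteq> {1..n}" "j \<in> {1..n}" "Y \<subseteq> {1..n}" "Y \<noteq> {1..n}" "i \<in> {1..n}"
    and jump: "jump n j X = jump n i Y" and land: "landing n X j = landing n Y i"
  shows "X = Y \<and> j = i"
proof -
  let ?k = "landing n X j"
  note k = landing[OF assms(1,2), of j] landing[OF assms(4,5), of i, folded land]
  show ?thesis
  proof (cases "?k \<in> jump n j X")
    case False
    then have "?k = j" unfolding jump_def by blast
    moreover have "?k \<notin> jump n i Y" using False jump by simp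
    then have "?k = i" unfolding land jump_def by blast
    ultimately have "j \<notin> X" "i \<notin> Y" using k(2,5) by auto
    then show ?thesis using jump_not_mem assms jump \<open>?k = j\<close> \<open>?k = i\<close> by metis
  next
    case True
    then have "?k \<noteq> j" by (auto simp: jump_def)
    moreover have "?k \<in> jump n i Y" using True jump by simp
    then have "?k \<noteq> i" by (auto simp: jump_def)
    ultimately have mem: "j \<in> X" "i \<in> Y"
      using landing_self assms(1,3,4,6) land by metis+
    have XY: "X - {j} = Y - {i}"
    proof -
      have "jump n j X - {?k} = X - {j}" using k(2) by (auto simp: jump_def)
      moreover have "jump n i Y - {?k} = Y - {i}" using k(5) by (auto simp: jump_def land)
      ultimately show ?thesis using jump by simp
    qed
    have "i = j"
    proof (rule ccontr)
      assume ne: "i \<noteq> j"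
      then consider "ring_dist n j i < ring_dist n j ?k" | "ring_dist n i j < ring_dist n i ?k"
        using ring_dist_between[OF assms(6,3) k(1) ne \<open>?k \<noteq> i\<close> \<open>?k \<noteq> j\<close>] by blast
      then show False
      proof cases
        case 1
        then have "i \<in> X" using k(3)[of i] assms(6) by (simp add: arc_def)
        then show False using XY ne by blast
      next
        case 2
        then have "j \<in> Y" using k(6)[of j] assms(3) by (simp add: arc_def)
        then show False using XY ne by blast
      qed
    qed
    then show ?thesis using XY mem by blast
  qed
qed

section \<open>Uniqueness of the stationary law\<close>

text \<open>
  The positive part of a signed invariant measure is invariant: it can only gain mass in the balance
  equation at each state, and the total mass is preserved.
\<close>

lemma invariant_pos_step:
  fixes d :: "'a \<Rightarrow> real" and T :: "'j \<Rightarrow> 'a \<Rightarrow> 'a"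
  assumes fin: "finite S" "finite J" and maps: "\<And>j s. j \<in> J \<Longrightarrow> s \<in> S \<Longrightarrow> T j s \<in> S"
    and rate: "\<And>j. j \<in> J \<Longrightarrow> 0 < rt j"
    and stat: "\<And>s. s \<in> S \<Longrightarrow>
      (\<Sum>j\<in>J. rt j * (\<Sum>s'\<in>S. d s' * of_bool (T j s' = s))) = (\<Sum>j\<in>J. rt j) * d s"
    and j: "j \<in> J" and s: "s \<in> S" "0 < d s"
  shows "0 < d (T j s)"
proof -
  let ?p = "\<lambda>s. max 0 (d s)" and ?\<Lambda> = "\<Sum>j\<in>J. rt j"
  let ?R = "\<lambda>s. \<Sum>j\<in>J. rt j * (\<Sum>s'\<in>S. ?p s' * of_bool (T j s' = s))"
  have \<Lambda>: "0 \<le> ?\<Lambda>" using rate by (intro sum_nonneg less_imp_le)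
  have le: "?\<Lambda> * ?p s \<le> ?R s" if "s \<in> S" for s
  proof (cases "0 \<le> d s")
    case True
    then have "?\<Lambda> * ?p s = (\<Sum>j\<in>J. rt j * (\<Sum>s'\<in>S. d s' * of_bool (T j s' = s)))"
      using stat[OF that] by simp
    also have "\<dots> \<le> ?R s"
      using rate by (intro sum_mono mult_left_mono) (auto intro: mult_right_mono less_imp_le)
    finally show ?thesis .
  next
    case False
    have "0 \<le> ?R s"
      using rate by (intro sum_nonneg mult_nonneg_nonneg) (auto intro: less_imp_le)
    then show ?thesis using False by simp
  qed
  have "(\<Sum>s\<in>S. ?R s) = (\<Sum>j\<in>J. rt j * (\<Sum>s'\<in>S. ?p s' * (\<Sum>s\<in>S. of_bool (T j s' = s))))"
  proof (subst sum.swap, intro sum.cong refl)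
    fix j
    have "(\<Sum>s\<in>S. \<Sum>s'\<in>S. ?p s' * of_bool (T j s' = s)) =
        (\<Sum>s'\<in>S. \<Sum>s\<in>S. ?p s' * of_bool (T j s' = s))" by (rule sum.swap)
    then show "(\<Sum>s\<in>S. rt j * (\<Sum>s'\<in>S. ?p s' * of_bool (T j s' = s))) =
        rt j * (\<Sum>s'\<in>S. ?p s' * (\<Sum>s\<in>S. of_bool (T j s' = s)))"
      by (simp flip: sum_distrib_left)
  qed
  also have "\<dots> = (\<Sum>j\<in>J. rt j * (\<Sum>s'\<in>S. ?p s'))"
  proof (intro sum.cong refl arg_cong2[where f="(*)"])
    fix j s' assume "j \<in> J" "s' \<in> S"
    then have "(\<Sum>s\<in>S. of_bool (T j s' = s)) = (1::real)"
      using maps fin(1) by (simp add: of_bool_def)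
    then show "?p s' * (\<Sum>s\<in>S. of_bool (T j s' = s)) = ?p s'" by simp
  qed
  also have "\<dots> = (\<Sum>s\<in>S. ?\<Lambda> * ?p s)"
    by (simp add: sum_distrib_left sum_distrib_right sum.swap[of _ J])
  finally have "?\<Lambda> * ?p (T j s) = ?R (T j s)"
    using sum_mono_inv[of "\<lambda>s. ?\<Lambda> * ?p s" S ?R "T j s"] le maps[OF j s(1)] fin(1) by simp
  moreover have "0 < ?R (T j s)"
  proof -
    have "0 < (\<Sum>s'\<in>S. ?p s' * of_bool (T j s' = T j s))"
      using fin s by (intro sum_pos2[of S s]) auto
    then have "0 < rt j * (\<Sum>s'\<in>S. ?p s' * of_bool (T j s' = T j s))"
      using rate[OF j] by (rule mult_pos_pos[rotated])
    moreover have "0 \<le> rt i * (\<Sum>s'\<in>S. ?p s' * of_bool (T i s' = T j s))" if "i \<in> J" for i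
      using rate[OF that] by (intro mult_nonneg_nonneg sum_nonneg) auto
    ultimately show ?thesis by (rule sum_pos2[OF fin(2) j])
  qed
  ultimately have "0 < ?\<Lambda> * ?p (T j s)" by simp
  then have "?p (T j s) \<noteq> 0" by (metis less_irrefl mult_zero_right)
  then show ?thesis by (auto simp: max_def split: if_splits)
qed

lemma invariant_pos_fold:
  fixes d :: "'a \<Rightarrow> real" and T :: "'j \<Rightarrow> 'a \<Rightarrow> 'a"
  assumes fin: "finite S" "finite J" and maps: "\<And>j s. j \<in> J \<Longrightarrow> s \<in> S \<Longrightarrow> T j s \<in> S"
    and rate: "\<And>j. j \<in> J \<Longrightarrow> 0 < rt j"
    and stat: "\<And>s. s \<in> S \<Longrightarrow>
      (\<Sum>j\<in>J. rt j * (\<Sum>s'\<in>S. d s' * of_bool (T j s' = s))) = (\<Sum>j\<in>J. rt j) * d s"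
    and "set ws \<subseteq> J" "s \<in> S" "0 < d s"
  shows "0 < d (fold T ws s)"
  using assms(6-8)
proof (induction ws arbitrary: s)
  case (Cons j ws)
  then have "T j s \<in> S" "0 < d (T j s)"
    using maps invariant_pos_step[OF fin maps rate stat] by auto
  then show ?case using Cons by simp
qed simp

text \<open>A word that sends all states to the same state forces positive and negative part to meet.\<close>

lemma invariant_eq_0:
  fixes d :: "'a \<Rightarrow> real" and T :: "'j \<Rightarrow> 'a \<Rightarrow> 'a"
  assumes fin: "finite S" "finite J" and maps: "\<And>j s. j \<in> J \<Longrightarrow> s \<in> S \<Longrightarrow> T j s \<in> S"
    and rate: "\<And>j. j \<in> J \<Longrightarrow> 0 < rt j"
    and stat: "\<And>s. s \<in> S \<Longrightarrow>
      (\<Sum>j\<in>J. rt j * (\<Sum>s'\<in>S. d s' * of_bool (T j s' = s))) = (\<Sum>j\<in>J. rt j) * d s"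
    and ws: "set ws \<subseteq> J" and sync: "\<And>s. s \<in> S \<Longrightarrow> fold T ws s = s0"
    and zero: "(\<Sum>s\<in>S. d s) = 0" and s: "s \<in> S"
  shows "d s = 0"
proof -
  have pos: "0 < d s0" if "s \<in> S" "0 < d s" for s
    using invariant_pos_fold[OF fin maps rate stat ws that] sync[OF that(1)] by simp
  have stat': "(\<Sum>j\<in>J. rt j * (\<Sum>s'\<in>S. - d s' * of_bool (T j s' = s))) = (\<Sum>j\<in>J. rt j) * - d s"
    if "s \<in> S" for s
    using stat[OF that] by (simp add: sum_negf)
  have neg: "0 < - d s0" if "s \<in> S" "0 < - d s" for s
    using invariant_pos_fold[OF fin maps rate stat' ws that] sync[OF that(1)] by simp
  have "(\<forall>s\<in>S. 0 \<le> d s) \<or> (\<forall>s\<in>S. 0 \<le> - d s)"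
  proof (cases "0 < d s0")
    case True
    then have "0 \<le> d s" if "s \<in> S" for s using neg[OF that] by linarith
    then show ?thesis by blast
  next
    case False
    then have "0 \<le> - d s" if "s \<in> S" for s using pos[OF that] by linarith
    then show ?thesis by blast
  qed
  then show ?thesis
  proof
    assume "\<forall>s\<in>S. 0 \<le> d s"
    then show ?thesis using sum_nonneg_eq_0_iff[of S d] fin(1) zero s by simp
  next
    assume "\<forall>s\<in>S. 0 \<le> - d s"
    then show ?thesis using sum_nonneg_eq_0_iff[of S "\<lambda>s. - d s"] fin(1) zero s by (simp add: sum_negf)
  qed
qed

lemma sum_fibres:
  fixes m :: "'c \<Rightarrow> real"
  assumes "finite S" "finite C" "\<And>c. c \<in> C \<Longrightarrow> L c \<in> S"
  shows "(\<Sum>s\<in>S. (\<Sum>c\<in>C. m c * of_bool (L c = s)) * g s) = (\<Sum>c\<in>C. m c * g (L c))"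
proof -
  have "(\<Sum>s\<in>S. (\<Sum>c\<in>C. m c * of_bool (L c = s)) * g s) =
      (\<Sum>c\<in>C. \<Sum>s\<in>S. m c * of_bool (L c = s) * g s)"
    unfolding sum_distrib_right by (rule sum.swap)
  also have "\<dots> = (\<Sum>c\<in>C. m c * g (L c))"
  proof (intro sum.cong refl)
    fix c assume "c \<in> C"
    have "(\<Sum>s\<in>S. m c * of_bool (L c = s) * g s) = (\<Sum>s\<in>S. if L c = s then m c * g s else 0)"
      by (intro sum.cong) auto
    then show "(\<Sum>s\<in>S. m c * of_bool (L c = s) * g s) = m c * g (L c)"
      using assms \<open>c \<in> C\<close> by simp
  qed
  finally show ?thesis .
qed

text \<open>The two measures may live on different spaces: only their images in \<open>S\<close> are
  compared. The difference of the images is a signed invariant measure of total mass zero.\<close>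

lemma projected_law_unique:
  fixes m :: "'c \<Rightarrow> real" and m' :: "'d \<Rightarrow> real" and T :: "'j \<Rightarrow> 'a \<Rightarrow> 'a"
  assumes fin: "finite S" "finite J" and maps: "\<And>j s. j \<in> J \<Longrightarrow> s \<in> S \<Longrightarrow> T j s \<in> S"
    and rate: "\<And>j. j \<in> J \<Longrightarrow> 0 < rt j"
    and ws: "set ws \<subseteq> J" and sync: "\<And>s. s \<in> S \<Longrightarrow> fold T ws s = s0"
    and C: "finite C" "\<And>c. c \<in> C \<Longrightarrow> L c \<in> S" and C': "finite C'" "\<And>c. c \<in> C' \<Longrightarrow> L' c \<in> S"
    and stat: "\<And>s. s \<in> S \<Longrightarrow> (\<Sum>j\<in>J. rt j * (\<Sum>c\<in>C. m c * of_bool (T j (L c) = s)))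
        = (\<Sum>j\<in>J. rt j) * (\<Sum>c\<in>C. m c * of_bool (L c = s))"
    and stat': "\<And>s. s \<in> S \<Longrightarrow> (\<Sum>j\<in>J. rt j * (\<Sum>c\<in>C'. m' c * of_bool (T j (L' c) = s)))
        = (\<Sum>j\<in>J. rt j) * (\<Sum>c\<in>C'. m' c * of_bool (L' c = s))"
    and mass: "(\<Sum>c\<in>C. m c) = (\<Sum>c\<in>C'. m' c)"
  shows "(\<Sum>c\<in>C. m c * g (L c)) = (\<Sum>c\<in>C'. m' c * g (L' c))"
proof -
  let ?\<rho> = "\<lambda>s. \<Sum>c\<in>C. m c * of_bool (L c = s)" and ?\<rho>' = "\<lambda>s. \<Sum>c\<in>C'. m' c * of_bool (L' c = s)"
  let ?d = "\<lambda>s. ?\<rho> s - ?\<rho>' s"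
  note fib = sum_fibres[where L=L and m=m, OF fin(1) C] and fib' = sum_fibres[where L=L' and m=m', OF fin(1) C']
  have "?d s = 0" if "s \<in> S" for s
  proof (rule invariant_eq_0[OF fin maps rate _ ws sync _ that, where d="?d"])
    fix s assume "s \<in> S"
    then show "(\<Sum>j\<in>J. rt j * (\<Sum>s'\<in>S. ?d s' * of_bool (T j s' = s))) = (\<Sum>j\<in>J. rt j) * ?d s"
      using stat stat' by (simp add: left_diff_distrib right_diff_distrib sum_subtractf fib fib')
  next
    show "(\<Sum>s\<in>S. ?d s) = 0"
      using fib[of "\<lambda>_. 1"] fib'[of "\<lambda>_. 1"] mass by (simp add: sum_subtractf)
  qed
  then have "(\<Sum>s\<in>S. ?\<rho> s * g s) = (\<Sum>s\<in>S. ?\<rho>' s * g s)" by (intro sum.cong) auto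
  then show ?thesis by (simp only: fib fib')
qed

text \<open>With \<open>m\<close> vacancies: while \<open>k < m\<close>, some vacancy lies beyond
  site \<open>k\<close>, so no particle wraps around and all sites rung so far are vacant. From then
  on the vacancies are the last \<open>m\<close> sites rung, and the particle at
  \<open>Suc k\<close> wraps around to the first of them, which shifts the block by one. The
  truncated subtraction covers both phases.\<close>

lemma fold_jump:
  assumes "X \<subseteq> {1..n}" "card X < n" "k \<le> n"
  shows "fold (jump n) [1..<Suc k] X \<subseteq> {1..n} \<and> card (fold (jump n) [1..<Suc k] X) = card X
    \<and> fold (jump n) [1..<Suc k] X \<inter> {1..k} = {1..k - (n - card X)}"
  using assms(3)
proof (induction k)
  case 0
  then show ?case using assms by simp
next
  case (Suc k)
  define Y where "Y = fold (jump n) [1..<Suc k] X"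
  let ?j = "Suc k" and ?m = "n - card X"
  have Y: "Y \<subseteq> {1..n}" "card Y = card X" "Y \<inter> {1..k} = {1..k - ?m}"
    using Suc unfolding Y_def by auto
  have ne: "Y \<noteq> {1..n}" using Y(2) assms(2) by auto
  have j: "?j \<in> {1..n}" using Suc by simp
  have fold: "fold (jump n) [1..<Suc ?j] X = jump n ?j Y" by (simp add: Y_def)
  let ?l = "landing n Y ?j"
  note l = landing[OF Y(1) ne, of ?j]
  have card_vac: "card ({1..n} - Y) = ?m"
    using Y(2) finite_subset[OF Y(1)] card_Diff_subset[OF _ Y(1)] by simp
  have "jump n ?j Y \<inter> {1..?j} = {1..?j - ?m}"
  proof (cases "k < ?m")
    case True
    have 1: "s \<notin> jump n ?j Y" if s: "s \<in> {1..k}" for s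
    proof
      assume "s \<in> jump n ?j Y"
      moreover have "s \<notin> Y" using Y(3) True s by auto
      ultimately have "s = ?l" by (auto simp: jump_def)
      then have "?j \<in> Y" using landing_self[OF Y(1) j] s by auto
      have "\<not> {1..n} - Y \<subseteq> {1..k}" using card_mono[of "{1..k}" "{1..n} - Y"] card_vac True by auto
      then obtain v where v: "v \<in> {1..n} - Y" "v \<notin> {1..k}" by blast
      then have "k < v" by auto
      then have "ring_dist n ?j s \<le> ring_dist n ?j v"
        using first_in_le[OF v(1), of n ?j] \<open>s = ?l\<close> by (simp add: landing_def)
      then show False using v \<open>k < v\<close> s j by (auto simp: ring_dist_def split: if_splits)
    qed
    have "?j \<notin> jump n ?j Y" by (simp add: jump_def)
    then have "jump n ?j Y \<inter> insert ?j {1..k} = {}" using 1 by blast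
    moreover have "{1..?j} = insert ?j {1..k}" by auto
    ultimately have "jump n ?j Y \<inter> {1..?j} = {}" by metis
    then show ?thesis using True by simp
  next
    case False
    have sub: "{Suc (k - ?m)..k} \<subseteq> {1..n} - Y"
    proof
      fix s assume s: "s \<in> {Suc (k - ?m)..k}"
      then have "s \<notin> Y \<inter> {1..k}" unfolding Y(3) by simp
      then show "s \<in> {1..n} - Y" using s Suc.prems by auto
    qed
    then have vac: "{1..n} - Y = {Suc (k - ?m)..k}"
      using card_vac False by (intro card_subset_eq[symmetric]) auto
    have "?j \<notin> {1..n} - Y" unfolding vac by simp
    then have "?j \<in> Y" using j by blast
    have "?l = Suc (k - ?m)"
      unfolding landing_def vac using j False assms(2)
      by (intro first_in_eqI) (auto simp: ring_dist_def)
    then have "jump n ?j Y \<inter> {1..?j} = insert (Suc (k - ?m)) (Y \<inter> {1..k})"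
      using False assms(2) by (auto simp: jump_def)
    also have "\<dots> = {1..?j - ?m}" unfolding Y(3) using False by auto
    finally show ?thesis .
  qed
  then show ?case
    unfolding fold using jump_subset[OF Y(1) ne] card_jump[OF Y(1) ne j] Y(2) by simp
qed

lemma fold_jump_sync:
  assumes "X \<subseteq> {1..n}" "card X < n"
  shows "fold (jump n) [1..<Suc n] X = {1..card X}"
  using fold_jump[OF assms order_refl] assms(2) by auto

lemma fold_pair: "fold (\<lambda>j (A, B). (f j A, g j B)) ws (A, B) = (fold f ws A, fold g ws B)"
  by (induction ws arbitrary: A B) auto

section \<open>Invariance of the two-line weight and the joint law of two level sets\<close>

definition subsets :: "nat \<Rightarrow> nat \<Rightarrow> nat set set" where
  "subsets n p = {X. X \<subseteq> {1..n} \<and> card X = p}"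

lemma finite_subsets [simp]: "finite (subsets n p)"
  unfolding subsets_def by (rule finite_subset[of _ "Pow {1..n}"]) auto

lemma elem_sym_eq: "elem_sym n x p = (\<Sum>X\<in>subsets n p. prod x X)"
  by (simp add: elem_sym_def subsets_def)

lemma finite_configs: "finite (configs n)"
proof (rule finite_subset)
  show "configs n \<subseteq> PiE {1..n} (\<lambda>_. {0..<n})"
    by (auto simp: configs_def PiE_def bij_betw_def)
  show "finite (PiE {1..n} (\<lambda>_. {0..<n}))" by (rule finite_PiE) auto
qed

lemma subsetsD:
  assumes "X \<in> subsets n p"
  shows "X \<subseteq> {1..n}" "card X = p" "p < n \<Longrightarrow> X \<noteq> {1..n}"
  using assms by (auto simp: subsets_def)

lemma subsets_jump: "X \<in> subsets n p \<Longrightarrow> p < n \<Longrightarrow> j \<in> {1..n} \<Longrightarrow> jump n j X \<in> subsets n p"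
  using jump_subset[of X n j] card_jump[of X n j] subsetsD[of X n p] by (simp add: subsets_def)

lemma landing_mem: "X \<in> subsets n p \<Longrightarrow> p < n \<Longrightarrow> landing n X j \<in> {1..n}"
  using landing(1) subsetsD by metis

text \<open>The product measure on two lines is invariant because the pair of jumps is a bijection of
  (lines, bell) that preserves weight times rate.\<close>

lemma two_line_stationary:
  fixes x :: "nat \<Rightarrow> real"
  assumes "p < q" "q < n" and x: "\<And>k. k \<in> {1..n} \<Longrightarrow> 0 < x k"
  shows "(\<Sum>j\<in>{1..n}. 1 / x j * (\<Sum>(R, B)\<in>subsets n p \<times> subsets n q. prod x R * prod x B *
      h (jump n j (departures n R B)) (jump n j B)))
    = (\<Sum>j\<in>{1..n}. 1 / x j) * (\<Sum>(R, B)\<in>subsets n p \<times> subsets n q. prod x R * prod x B *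
      h (departures n R B) B)"
proof -
  let ?E = "{1..n} \<times> (subsets n p \<times> subsets n q)"
  define \<Psi> where "\<Psi> = (\<lambda>(j, R, B). let k = landing n B j in (landing n R k, jump n k R, jump n j B))"
  have \<Psi>_E: "\<Psi> e \<in> ?E" if "e \<in> ?E" for e
  proof -
    obtain j R B where e: "e = (j, R, B)" by (cases e)
    then have "j \<in> {1..n}" "R \<in> subsets n p" "B \<in> subsets n q" "p < n" using that assms by auto
    then show ?thesis
      unfolding e \<Psi>_def Let_def using assms(2) landing_mem subsets_jump by simp
  qed
  have "inj_on \<Psi> ?E"
  proof (rule inj_onI)
    fix e e' assume e: "e \<in> ?E" and e': "e' \<in> ?E" and eq: "\<Psi> e = \<Psi> e'"
    obtain j R B j' R' B' where [simp]: "e = (j, R, B)" "e' = (j', R', B')" by (cases e, cases e') auto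
    let ?k = "landing n B j" and ?k' = "landing n B' j'"
    have jRB: "j \<in> {1..n}" "R \<in> subsets n p" "B \<in> subsets n q"
      and jRB': "j' \<in> {1..n}" "R' \<in> subsets n p" "B' \<in> subsets n q"
      and pn: "p < n" using e e' assms by auto
    have eq': "landing n R ?k = landing n R' ?k'" "jump n ?k R = jump n ?k' R'" "jump n j B = jump n j' B'"
      using eq by (auto simp: \<Psi>_def Let_def)
    \<comment> \<open>The jumps are undone in reverse order: the new bell and arrival line recover
      \<open>R\<close> and the bell \<open>?k\<close>, which is the landing site needed to recover
      the service line.\<close>
    have R: "R = R' \<and> ?k = ?k'"
      by (rule jump_inj[OF subsetsD(1)[OF jRB(2)] subsetsD(3)[OF jRB(2) pn] landing_mem[OF jRB(3) assms(2)]
          subsetsD(1)[OF jRB'(2)] subsetsD(3)[OF jRB'(2) pn] landing_mem[OF jRB'(3) assms(2)] eq'(2,1)])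
    then have "?k = ?k'" ..
    then have "B = B' \<and> j = j'"
      by (rule jump_inj[OF subsetsD(1)[OF jRB(3)] subsetsD(3)[OF jRB(3) assms(2)] jRB(1)
          subsetsD(1)[OF jRB'(3)] subsetsD(3)[OF jRB'(3) assms(2)] jRB'(1) eq'(3)])
    then show "e = e'" using R by simp
  qed
  moreover have "\<Psi> ` ?E \<subseteq> ?E" using \<Psi>_E by blast
  ultimately have "\<Psi> ` ?E = ?E" by (intro endo_inj_surj) simp_all
  with \<open>inj_on \<Psi> ?E\<close> have bij: "bij_betw \<Psi> ?E ?E" by (simp add: bij_betw_def)
  let ?F = "\<lambda>(j, R, B). 1 / x j * (prod x R * prod x B * h (departures n R B) B)"
  have "(\<Sum>(j, R, B)\<in>?E. 1 / x j * (prod x R * prod x B *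
      h (jump n j (departures n R B)) (jump n j B))) = (\<Sum>e\<in>?E. ?F (\<Psi> e))"
  proof (intro sum.cong refl, clarify)
    fix j R B assume j: "j \<in> {1..n}" and R: "R \<in> subsets n p" and B: "B \<in> subsets n q"
    let ?k = "landing n B j"
    have pn: "p < n" using assms by simp
    have k: "?k \<in> {1..n}" using landing_mem[OF B assms(2)] .
    have dep: "departures n (jump n ?k R) (jump n j B) = jump n j (departures n R B)"
      using subsetsD[OF R] subsetsD[OF B] assms j by (intro departures_jump) auto
    have "prod x R * prod x B / x j = prod x R * (prod x (jump n j B) / x ?k)"
      using prod_jump[where x=x, OF subsetsD(1)[OF B] subsetsD(3)[OF B assms(2)] j x] by simp
    also have "\<dots> = (prod x R / x ?k) * prod x (jump n j B)" by simp
    also have "\<dots> = prod x (jump n ?k R) / x (landing n R ?k) * prod x (jump n j B)"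
      using prod_jump[where x=x, OF subsetsD(1)[OF R] subsetsD(3)[OF R pn] k x] by simp
    finally have eq: "prod x R * prod x B / x j =
      prod x (jump n ?k R) / x (landing n R ?k) * prod x (jump n j B)" .
    let ?h = "h (jump n j (departures n R B)) (jump n j B)"
    have "1 / x j * (prod x R * prod x B * ?h) = prod x R * prod x B / x j * ?h" by simp
    also have "\<dots> = ?F (\<Psi> (j, R, B))" unfolding eq by (simp add: \<Psi>_def Let_def dep)
    finally show "1 / x j * (prod x R * prod x B * ?h) = ?F (\<Psi> (j, R, B))" .
  qed
  also have "\<dots> = (\<Sum>e\<in>?E. ?F e)" by (rule sum.reindex_bij_betw[OF bij])
  finally show ?thesis
    by (subst sum_distrib_right) (simp add: sum.cartesian_product[symmetric] sum_distrib_left)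
qed

text \<open>The balance equations are integrated against a function of two level sets, on which
  every bell acts through \<open>jump\<close>.\<close>

lemma level_stationary:
  assumes "stationary n x \<pi>" "0 < u" "0 < t"
  shows "(\<Sum>j\<in>{1..n}. 1 / x j * (\<Sum>\<eta>\<in>configs n. pmf \<pi> \<eta> *
      h (jump n j (level n u \<eta>)) (jump n j (level n t \<eta>))))
    = (\<Sum>j\<in>{1..n}. 1 / x j) * (\<Sum>\<eta>\<in>configs n. pmf \<pi> \<eta> * h (level n u \<eta>) (level n t \<eta>))"
proof -
  let ?C = "configs n" and ?h = "\<lambda>\<eta>. h (level n u \<eta>) (level n t \<eta>)"
  have "0 = (\<Sum>\<xi>\<in>?C. (\<Sum>\<eta>\<in>?C. pmf \<pi> \<eta> * generator n x \<eta> \<xi>) * ?h \<xi>)"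
    using assms(1) by (simp add: stationary_def)
  also have "\<dots> = (\<Sum>\<eta>\<in>?C. \<Sum>\<xi>\<in>?C. pmf \<pi> \<eta> * generator n x \<eta> \<xi> * ?h \<xi>)"
    unfolding sum_distrib_right by (rule sum.swap)
  also have "\<dots> = (\<Sum>\<eta>\<in>?C. \<Sum>j\<in>{1..n}. pmf \<pi> \<eta> * (1 / x j * (?h (ring_bell n j \<eta>) - ?h \<eta>)))"
  proof (intro sum.cong refl)
    fix \<eta> assume \<eta>: "\<eta> \<in> ?C"
    have pick: "(\<Sum>\<xi>\<in>?C. of_bool (\<zeta> = \<xi>) * ?h \<xi>) = ?h \<zeta>" if "\<zeta> \<in> ?C" for \<zeta>
      using that finite_configs[of n] by (simp add: of_bool_def if_distrib[of "\<lambda>z. z * _"] cong: if_cong)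
    have "(\<Sum>\<xi>\<in>?C. pmf \<pi> \<eta> * generator n x \<eta> \<xi> * ?h \<xi>) =
        (\<Sum>\<xi>\<in>?C. \<Sum>j\<in>{1..n}. pmf \<pi> \<eta> * (1 / x j *
          (of_bool (ring_bell n j \<eta> = \<xi>) * ?h \<xi> - of_bool (\<eta> = \<xi>) * ?h \<xi>)))"
      unfolding generator_def sum_distrib_left sum_distrib_right
      by (intro sum.cong refl) (simp add: algebra_simps)
    also have "\<dots> = (\<Sum>j\<in>{1..n}. \<Sum>\<xi>\<in>?C. pmf \<pi> \<eta> * (1 / x j *
          (of_bool (ring_bell n j \<eta> = \<xi>) * ?h \<xi> - of_bool (\<eta> = \<xi>) * ?h \<xi>)))"
      by (rule sum.swap)
    also have "\<dots> = (\<Sum>j\<in>{1..n}. pmf \<pi> \<eta> * (1 / x j * (?h (ring_bell n j \<eta>) - ?h \<eta>)))"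
      unfolding sum_distrib_left[symmetric] sum_subtractf
      using pick[OF \<eta>] pick[OF ring_bell_configs[OF \<eta>]] by simp
    finally show "(\<Sum>\<xi>\<in>?C. pmf \<pi> \<eta> * generator n x \<eta> \<xi> * ?h \<xi>) =
      (\<Sum>j\<in>{1..n}. pmf \<pi> \<eta> * (1 / x j * (?h (ring_bell n j \<eta>) - ?h \<eta>)))" .
  qed
  also have "\<dots> = (\<Sum>j\<in>{1..n}. \<Sum>\<eta>\<in>?C. 1 / x j * (pmf \<pi> \<eta> * ?h (ring_bell n j \<eta>)) - 1 / x j * (pmf \<pi> \<eta> * ?h \<eta>))"
    by (subst sum.swap, intro sum.cong refl) (simp add: algebra_simps)
  also have "\<dots> = (\<Sum>j\<in>{1..n}. 1 / x j * (\<Sum>\<eta>\<in>?C. pmf \<pi> \<eta> * ?h (ring_bell n j \<eta>)))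
      - (\<Sum>j\<in>{1..n}. 1 / x j) * (\<Sum>\<eta>\<in>?C. pmf \<pi> \<eta> * ?h \<eta>)"
    by (subst sum_distrib_right) (simp add: sum_subtractf sum_distrib_left)
  also have "(\<Sum>j\<in>{1..n}. 1 / x j * (\<Sum>\<eta>\<in>?C. pmf \<pi> \<eta> * ?h (ring_bell n j \<eta>))) =
      (\<Sum>j\<in>{1..n}. 1 / x j * (\<Sum>\<eta>\<in>configs n. pmf \<pi> \<eta> *
        h (jump n j (level n u \<eta>)) (jump n j (level n t \<eta>))))"
    using assms(2,3) by (intro sum.cong refl arg_cong2[where f="(*)"]) (simp add: level_ring_bell)
  finally show ?thesis by simp
qed

lemma elem_sym_pos:
  assumes "\<And>k. k \<in> {1..n} \<Longrightarrow> 0 < x k" "r \<le> n"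
  shows "0 < elem_sym n x r"
proof -
  have pos: "0 < prod x X" if "X \<subseteq> {1..n}" for X
    using assms(1) that by (intro prod_pos) blast
  have "{1..r} \<in> subsets n r" using assms(2) by (simp add: subsets_def)
  then show ?thesis
    unfolding elem_sym_eq using pos subsetsD(1) assms(2)
    by (intro sum_pos2[of _ "{1..r}"]) (auto intro: less_imp_le)
qed

lemma sum_pmf_configs: "stationary n x \<pi> \<Longrightarrow> (\<Sum>\<eta>\<in>configs n. pmf \<pi> \<eta>) = 1"
  using finite_configs by (intro sum_pmf_eq_1) (auto simp: stationary_def)

text \<open>Level pairs and queue pairs move by the same jumps within sets of fixed sizes, and one
  round of bells leads to a state depending only on these sizes. Admitting \<open>u = n\<close>,
  with no arrivals, also yields the law of one level.\<close>

lemma pair_law: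
  fixes x :: "nat \<Rightarrow> real"
  assumes \<pi>: "stationary n x \<pi>" and x: "\<And>k. k \<in> {1..n} \<Longrightarrow> 0 < x k"
    and tu: "0 < t" "t < u" "u \<le> n"
  shows "(\<Sum>\<eta>\<in>configs n. pmf \<pi> \<eta> * g (level n u \<eta>) (level n t \<eta>)) =
    (\<Sum>R\<in>subsets n (n - u). \<Sum>B\<in>subsets n (n - t). prod x R * prod x B * g (departures n R B) B)
      / (elem_sym n x (n - u) * elem_sym n x (n - t))"
proof -
  let ?p = "n - u" and ?q = "n - t"
  have pq: "?p < ?q" "?q < n" "?p < n" using tu by auto
  let ?S = "subsets n ?p \<times> subsets n ?q"
  define T :: "nat \<Rightarrow> nat set \<times> nat set \<Rightarrow> nat set \<times> nat set"
    where "T = (\<lambda>j (A, B). (jump n j A, jump n j B))"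
  define L where "L = (\<lambda>\<eta>. (level n u \<eta>, level n t \<eta>))"
  define L' where "L' = (\<lambda>(R, B). (departures n R B, B))"
  define Z where "Z = elem_sym n x ?p * elem_sym n x ?q"
  define m' where "m' = (\<lambda>(R, B). prod x R * prod x B / Z)"
  have "0 < Z" unfolding Z_def using elem_sym_pos[of n x] x by simp
  have "(\<Sum>\<eta>\<in>configs n. pmf \<pi> \<eta> * case_prod g (L \<eta>)) = (\<Sum>c\<in>?S. m' c * case_prod g (L' c))"
  proof (rule projected_law_unique[where T=T and J="{1..n}" and rt="\<lambda>j. 1 / x j" and S="?S"
        and ws="[1..<Suc n]" and ?s0.0="({1..?p}, {1..?q})"])
    show "T j s \<in> ?S" if "j \<in> {1..n}" "s \<in> ?S" for j s
      using that pq by (auto simp: T_def intro!: subsets_jump)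
    show "fold T [1..<Suc n] s = ({1..?p}, {1..?q})" if "s \<in> ?S" for s
    proof -
      obtain A B where s: "s = (A, B)" by fastforce
      show ?thesis
        using that pq fold_jump_sync[of A n] fold_jump_sync[of B n]
        unfolding s T_def fold_pair by (auto simp: subsets_def)
    qed
    show "L \<eta> \<in> ?S" if "\<eta> \<in> configs n" for \<eta>
      using that tu by (auto simp: L_def subsets_def card_level) (auto simp: level_def)
    show "L' c \<in> ?S" if "c \<in> ?S" for c
    proof -
      obtain R B where c: "c = (R, B)" by fastforce
      have R: "R \<subseteq> {1..n}" "B \<subseteq> {1..n}" "card R < card B" "card R = ?p" "card B = ?q"
        using that pq by (auto simp: c subsets_def)
      have "departures n R B \<subseteq> {1..n}" using departures_subset[OF R(1-3)] R(2) by blast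
      then show ?thesis using R card_departures[OF R(1-3)] by (simp add: L'_def c subsets_def)
    qed
    show "(\<Sum>j\<in>{1..n}. 1 / x j * (\<Sum>\<eta>\<in>configs n. pmf \<pi> \<eta> * of_bool (T j (L \<eta>) = s)))
        = (\<Sum>j\<in>{1..n}. 1 / x j) * (\<Sum>\<eta>\<in>configs n. pmf \<pi> \<eta> * of_bool (L \<eta> = s))" for s
      using level_stationary[OF \<pi>, of u t "\<lambda>A B. of_bool ((A, B) = s)"] tu
      by (simp add: T_def L_def)
    show "(\<Sum>j\<in>{1..n}. 1 / x j * (\<Sum>c\<in>?S. m' c * of_bool (T j (L' c) = s)))
        = (\<Sum>j\<in>{1..n}. 1 / x j) * (\<Sum>c\<in>?S. m' c * of_bool (L' c = s))" for s
      using two_line_stationary[OF pq(1,2) x, where h = "\<lambda>A B. of_bool ((A, B) = s) / Z"]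
      by (simp add: T_def L'_def m'_def case_prod_beta)
    have "(\<Sum>c\<in>?S. m' c) = 1"
    proof -
      have "(\<Sum>c\<in>?S. m' c) = (\<Sum>R\<in>subsets n ?p. prod x R) * (\<Sum>B\<in>subsets n ?q. prod x B) / Z"
        by (simp add: m'_def sum.cartesian_product[symmetric] sum_product sum_divide_distrib)
      also have "\<dots> = Z / Z" by (simp add: Z_def elem_sym_eq)
      also have "\<dots> = 1" using \<open>0 < Z\<close> by simp
      finally show ?thesis .
    qed
    then show "(\<Sum>\<eta>\<in>configs n. pmf \<pi> \<eta>) = (\<Sum>c\<in>?S. m' c)" by (simp add: sum_pmf_configs[OF \<pi>])
  qed (use x finite_configs in auto)
  also have "\<dots> = (\<Sum>(R, B)\<in>?S. prod x R * prod x B * g (departures n R B) B / Z)"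
    by (intro sum.cong) (auto simp: L'_def m'_def)
  also have "\<dots> = (\<Sum>R\<in>subsets n ?p. \<Sum>B\<in>subsets n ?q. prod x R * prod x B * g (departures n R B) B) / Z"
    by (simp add: sum.cartesian_product[symmetric] sum_divide_distrib)
  finally show ?thesis by (simp add: L_def Z_def)
qed

text \<open>The integer degree makes terms of negative degree vanish without case distinctions; the
  variable set of sites permits splitting off sites 1 and 2.\<close>

definition esym :: "nat set \<Rightarrow> (nat \<Rightarrow> real) \<Rightarrow> int \<Rightarrow> real" where
  "esym M x k = (\<Sum>S\<in>Pow M. of_bool (int (card S) = k) * prod x S)"

lemma sum_Pow_insert:
  fixes f :: "'a set \<Rightarrow> real"
  assumes "finite M" "z \<notin> M"
  shows "(\<Sum>S\<in>Pow (insert z M). f S) = (\<Sum>S\<in>Pow M. f S + f (insert z S))"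
proof -
  have inj: "inj_on (insert z) (Pow M)" using assms(2)
    by (intro inj_onI) (metis Diff_insert_absorb PowD subsetD)
  have "Pow M \<inter> insert z ` Pow M = {}" using assms(2) by auto
  then have "(\<Sum>S\<in>Pow (insert z M). f S) = (\<Sum>S\<in>Pow M. f S) + (\<Sum>S\<in>insert z ` Pow M. f S)"
    unfolding Pow_insert using assms(1) by (intro sum.union_disjoint) auto
  then show ?thesis by (simp add: sum.reindex[OF inj] sum.distrib)
qed

lemma sum_Pow_insert2:
  fixes f :: "'a set \<Rightarrow> real"
  assumes "finite M" "z \<notin> M" "w \<notin> insert z M"
  shows "(\<Sum>S\<in>Pow (insert w (insert z M)). f S) =
    (\<Sum>S\<in>Pow M. f S + f (insert z S) + (f (insert w S) + f (insert w (insert z S))))"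
proof -
  have fin: "finite (insert z M)" using assms(1) by simp
  show ?thesis
    unfolding sum_Pow_insert[OF fin assms(3)] sum_Pow_insert[OF assms(1,2)] by (simp only: sum.distrib)
qed

lemma Pow_memD:
  assumes "finite M" "z \<notin> M" "S \<in> Pow M"
  shows "finite S" "z \<notin> S"
  using assms finite_subset by auto

lemma esym_insert:
  assumes "finite M" "z \<notin> M"
  shows "esym (insert z M) x k = esym M x k + x z * esym M x (k - 1)"
proof -
  have "esym (insert z M) x k = (\<Sum>S\<in>Pow M. of_bool (int (card S) = k) * prod x S
      + x z * (of_bool (int (card S) = k - 1) * prod x S))"
    unfolding esym_def sum_Pow_insert[OF assms]
  proof (intro sum.cong refl)
    fix S assume "S \<in> Pow M"
    then show "of_bool (int (card S) = k) * prod x S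
      + of_bool (int (card (insert z S)) = k) * prod x (insert z S) =
      of_bool (int (card S) = k) * prod x S + x z * (of_bool (int (card S) = k - 1) * prod x S)"
      using Pow_memD[OF assms, of S] by auto
  qed
  then show ?thesis by (simp add: esym_def sum.distrib sum_distrib_left)
qed

lemma esym_neg: "k < 0 \<Longrightarrow> esym M x k = 0"
  unfolding esym_def by (intro sum.neutral) auto

lemma esym_empty: "esym {} x k = of_bool (k = 0)"
  by (simp add: esym_def)

lemma sum_subsets:
  fixes f :: "nat set \<Rightarrow> real"
  shows "(\<Sum>S\<in>subsets n p. f S) = (\<Sum>S\<in>Pow {1..n}. of_bool (card S = p) * f S)"
  unfolding subsets_def by (intro sum.mono_neutral_cong_left) auto

lemma elem_sym_esym: "elem_sym n x p = esym {1..n} x (int p)"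
  by (simp add: elem_sym_eq sum_subsets esym_def)

lemma sites_split: "2 \<le> n \<Longrightarrow> {1..n} = insert 1 (insert (2::nat) {3..n})"
  by auto

lemma esym_sites:
  assumes "2 \<le> n"
  shows "esym {1..n} x k = esym {3..n} x k + (x 1 + x 2) * esym {3..n} x (k - 1)
    + x 1 * x 2 * esym {3..n} x (k - 2)"
  unfolding sites_split[OF assms] by (simp add: esym_insert algebra_simps)

section \<open>Counting queues on a line\<close>

text \<open>The truncated subtraction discards a service that meets an empty queue.\<close>

fun line_queue :: "nat set \<Rightarrow> nat set \<Rightarrow> nat \<Rightarrow> nat" where
  "line_queue R B 0 = 0"
| "line_queue R B (Suc m) = (if Suc m \<le> 2 then 0
     else line_queue R B m + of_bool (Suc m \<in> R) - of_bool (Suc m \<in> B))"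

lemma line_queue_le_2: "m \<le> 2 \<Longrightarrow> line_queue R B m = 0"
  by (cases m) auto

lemma line_queue_cong:
  assumes "\<And>s. 3 \<le> s \<Longrightarrow> s \<le> m \<Longrightarrow> (s \<in> R \<longleftrightarrow> s \<in> R') \<and> (s \<in> B \<longleftrightarrow> s \<in> B')"
  shows "line_queue R B m = line_queue R' B' m"
  using assms by (induction m) auto

definition line_sum :: "(nat \<Rightarrow> real) \<Rightarrow> nat \<Rightarrow> int \<Rightarrow> int \<Rightarrow> int \<Rightarrow> real" where
  "line_sum x m a b C = (\<Sum>R\<in>Pow {3..m}. \<Sum>B\<in>Pow {3..m}.
     of_bool (int (card R) = a \<and> int (card B) = b \<and> int (line_queue R B m) \<le> C) * (prod x R * prod x B))"

text \<open>The four terms are the possible contents of the last site. For a service alone, the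
  truncated length minus one is at most \<open>C\<close> iff the length is at most
  \<open>C + 1\<close>, which needs \<open>0 \<le> C\<close>.\<close>

lemma line_sum_Suc:
  assumes "2 \<le> m" "0 \<le> C"
  shows "line_sum x (Suc m) a b C = line_sum x m a b C + x (Suc m) * line_sum x m (a - 1) b (C - 1)
    + x (Suc m) * line_sum x m a (b - 1) (C + 1) + x (Suc m) ^ 2 * line_sum x m (a - 1) (b - 1) C"
proof -
  let ?z = "Suc m" and ?M = "{3..m}"
  let ?w = "\<lambda>a b C R B. of_bool (int (card R) = a \<and> int (card B) = b \<and> int (line_queue R B m) \<le> C)
    * (prod x R * prod x B)"
  let ?v = "\<lambda>R B. of_bool (int (card R) = a \<and> int (card B) = b \<and> int (line_queue R B ?z) \<le> C)
    * (prod x R * prod x B)"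
  have M: "{3..?z} = insert ?z ?M" "finite ?M" "?z \<notin> ?M" using assms by auto
  have "line_sum x ?z a b C = (\<Sum>R\<in>Pow ?M. \<Sum>B\<in>Pow ?M.
      ?v R B + ?v R (insert ?z B) + (?v (insert ?z R) B + ?v (insert ?z R) (insert ?z B)))"
    unfolding line_sum_def M(1) sum_Pow_insert[OF M(2,3)] sum.distrib by (simp only:)
  also have "\<dots> = (\<Sum>R\<in>Pow ?M. \<Sum>B\<in>Pow ?M. ?w a b C R B + x ?z * ?w (a - 1) b (C - 1) R B
      + x ?z * ?w a (b - 1) (C + 1) R B + x ?z ^ 2 * ?w (a - 1) (b - 1) C R B)"
  proof (intro sum.cong refl)
    fix R B assume RB: "R \<in> Pow ?M" "B \<in> Pow ?M"
    note R = Pow_memD[OF M(2,3) RB(1)] and B = Pow_memD[OF M(2,3) RB(2)]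
    have q: "line_queue (insert ?z R) B m = line_queue R B m"
      "line_queue R (insert ?z B) m = line_queue R B m"
      "line_queue (insert ?z R) (insert ?z B) m = line_queue R B m"
      by (auto intro: line_queue_cong)
    have "?v R B = ?w a b C R B" using assms R B by simp
    moreover have "?v R (insert ?z B) = x ?z * ?w a (b - 1) (C + 1) R B"
      using assms R B q by (auto simp: nat_le_iff)
    moreover have "?v (insert ?z R) B = x ?z * ?w (a - 1) b (C - 1) R B"
      using assms R B q by auto
    moreover have "?v (insert ?z R) (insert ?z B) = x ?z ^ 2 * ?w (a - 1) (b - 1) C R B"
      using assms R B q by (auto simp: power2_eq_square)
    ultimately show "?v R B + ?v R (insert ?z B) + (?v (insert ?z R) B + ?v (insert ?z R) (insert ?z B))
      = ?w a b C R B + x ?z * ?w (a - 1) b (C - 1) R B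
      + x ?z * ?w a (b - 1) (C + 1) R B + x ?z ^ 2 * ?w (a - 1) (b - 1) C R B"
      by (simp only: add.assoc)
  qed
  also have "\<dots> = line_sum x m a b C + x ?z * line_sum x m (a - 1) b (C - 1)
    + x ?z * line_sum x m a (b - 1) (C + 1) + x ?z ^ 2 * line_sum x m (a - 1) (b - 1) C"
    unfolding line_sum_def sum_distrib_left sum.distrib by (simp only:)
  finally show ?thesis .
qed

text \<open>Reflection principle. The value \<open>C = - 1\<close> is the absorbing boundary of the recursion.\<close>

lemma line_sum_eq:
  assumes "2 \<le> m" "- 1 \<le> C" "a \<le> b + C + 1"
  shows "line_sum x m a b C = esym {3..m} x a * esym {3..m} x b
    - esym {3..m} x (a - C - 1) * esym {3..m} x (b + C + 1)"
  using assms
proof (induction m arbitrary: a b C rule: dec_induct)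
  case base
  \<comment> \<open>With no sites, the reflected product lives at \<open>a = C + 1\<close>,
    \<open>b = - C - 1\<close>; the hypothesis on \<open>a\<close> permits this only for
    \<open>C = - 1\<close>, where the two products cancel.\<close>
  then show ?case by (auto simp: line_sum_def esym_empty line_queue_le_2)
next
  case (step m)
  show ?case
  proof (cases "C = - 1")
    case True
    then show ?thesis by (simp add: line_sum_def)
  next
    case False
    have M: "{3..Suc m} = insert (Suc m) {3..m}" "finite {3..m}" "Suc m \<notin> {3..m}"
      using step.hyps by auto
    have "line_sum x (Suc m) a b C = line_sum x m a b C + x (Suc m) * line_sum x m (a - 1) b (C - 1)
      + x (Suc m) * line_sum x m a (b - 1) (C + 1) + x (Suc m) ^ 2 * line_sum x m (a - 1) (b - 1) C"
      using step.hyps step.prems False by (intro line_sum_Suc) auto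
    then show ?thesis
      using step.prems False
      by (simp add: step.IH M(1) esym_insert[OF M(2,3)] power2_eq_square algebra_simps)
  qed
qed

section \<open>Cutting the ring at an unused service\<close>

text \<open>Lindley's recursion: the lengths evolve without reference to the departures.\<close>

lemma is_queue_max:
  assumes "is_queue n R B A c" "s \<in> {1..n}"
  shows "c s = max 0 (c (pred_site n s) + of_bool (s \<in> R) - of_bool (s \<in> B))"
  using is_queueD(1)[OF assms(1)] is_queueD(2-4)[OF assms] is_queueD(2)[OF assms(1) pred_site_mem[OF assms(2)]]
  by (cases "s \<in> A"; cases "s \<in> B"; cases "s \<in> R") auto

lemma is_queue_line:
  assumes q: "is_queue n R B A c" and "c 2 = 0" "2 \<le> m" "m \<le> n"
  shows "c m = int (line_queue R B m)"
  using assms(3,4)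
proof (induction m rule: dec_induct)
  case base
  then show ?case using assms(2) by (simp add: line_queue_le_2)
next
  case (step m)
  have "c (Suc m) = max 0 (c m + of_bool (Suc m \<in> R) - of_bool (Suc m \<in> B))"
    using is_queue_max[OF q, of "Suc m"] step by (simp add: pred_site_def)
  then show ?case using step by (auto simp: of_bool_def)
qed

text \<open>The line closes up to a ring if the service at 1 absorbs all that is left after
  \<open>n\<close> together with an arrival at 1; the service at 2 then absorbs an arrival at 2, and
  the line indeed starts empty.\<close>

lemma line_is_queue:
  assumes "2 \<le> n" "1 \<in> B" "2 \<in> B" "line_queue R B n + of_bool (1 \<in> R) \<le> 1"
  defines "c \<equiv> \<lambda>s. if s = 1 then 0 else int (line_queue R B s)"
  assumes "B \<subseteq> {1..n}"
  shows "is_queue n R B {s \<in> B. 0 < c (pred_site n s) + of_bool (s \<in> R)} c"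
proof -
  have c: "0 \<le> c s \<and> c s = max 0 (c (pred_site n s) + of_bool (s \<in> R) - of_bool (s \<in> B))"
    if s: "s \<in> {1..n}" for s
  proof -
    consider "s = 1" | "s = 2" | m where "s = Suc m" "2 \<le> m"
      using s by (cases s) (auto, fastforce)
    then show ?thesis
    proof cases
      case 1
      then show ?thesis using assms(1,2,4) by (auto simp: c_def pred_site_def)
    next
      case 2
      then show ?thesis using assms(3) by (auto simp: c_def pred_site_def line_queue_le_2)
    next
      case 3
      then show ?thesis by (auto simp: c_def pred_site_def of_bool_def)
    qed
  qed
  have nonneg: "0 \<le> c s" for s by (simp add: c_def)
  show ?thesis
    unfolding is_queue_def
  proof (intro conjI ballI impI)
    fix s assume s: "s \<in> {1..n}"
    note cs = c[OF s] and nn = nonneg[of "pred_site n s"]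
    show "0 \<le> c s" using cs by blast
    show "c s = c (pred_site n s) + of_bool (s \<in> R)
        - of_bool (s \<in> {s \<in> B. 0 < c (pred_site n s) + of_bool (s \<in> R)})"
      using cs nn by (cases "s \<in> R"; cases "s \<in> B") auto
    show "c s = 0" if "s \<in> B - {s \<in> B. 0 < c (pred_site n s) + of_bool (s \<in> R)}"
      using cs nn that by auto
  qed blast
qed

lemma departures_cut:
  assumes "2 \<le> n" "R \<subseteq> {1..n}" "B \<subseteq> {1..n}" "card R < card B" "1 \<in> B" "2 \<in> B"
  shows "2 \<notin> departures n R B \<longleftrightarrow> 2 \<notin> R \<and> line_queue R B n + of_bool (1 \<in> R) \<le> 1"
    and "1 \<notin> departures n R B \<longleftrightarrow> 1 \<notin> R \<and> line_queue R B n = 0"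
proof -
  let ?D = "departures n R B"
  obtain c where q: "is_queue n R B ?D c" using departures assms(2-4) by blast
  have sites: "1 \<in> {1..n}" "2 \<in> {1..n}" "n \<in> {1..n}" using assms(1) by auto
  have pred: "pred_site n 1 = n" "pred_site n 2 = 1" by (simp_all add: pred_site_def)
  note c1 = is_queueD(2,3)[OF q sites(1), unfolded pred] is_queue_max[OF q sites(1), unfolded pred]
    and c2 = is_queueD(2,3)[OF q sites(2), unfolded pred] is_queue_max[OF q sites(2), unfolded pred]
    and cn = is_queueD(2)[OF q sites(3)]
  have line: "c n = int (line_queue R B n)" if "c 2 = 0"
    using is_queue_line[OF q that] assms(1) by simp
  let ?c = "\<lambda>s. if s = 1 then 0 else int (line_queue R B s)"
  have D: "?D = {s \<in> B. 0 < ?c (pred_site n s) + of_bool (s \<in> R)}"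
    if "line_queue R B n + of_bool (1 \<in> R) \<le> 1"
    using line_is_queue[OF assms(1,5,6) that assms(3)] assms(2-4) by (rule departures_eqI)
  show "2 \<notin> ?D \<longleftrightarrow> 2 \<notin> R \<and> line_queue R B n + of_bool (1 \<in> R) \<le> 1"
  proof
    assume "2 \<notin> ?D"
    then have "c 2 = 0" using is_queueD(4)[OF q sites(2) assms(6)] by simp
    moreover have "c 1 = 0" "2 \<notin> R" using c1 c2 \<open>c 2 = 0\<close> \<open>2 \<notin> ?D\<close> by (auto split: if_splits simp: of_bool_def)
    ultimately show "2 \<notin> R \<and> line_queue R B n + of_bool (1 \<in> R) \<le> 1"
      using line c1(3) assms(5) by (auto simp: of_bool_def split: if_splits)
  next
    assume "2 \<notin> R \<and> line_queue R B n + of_bool (1 \<in> R) \<le> 1"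
    then show "2 \<notin> ?D" using D by (simp add: pred)
  qed
  show "1 \<notin> ?D \<longleftrightarrow> 1 \<notin> R \<and> line_queue R B n = 0"
  proof
    assume "1 \<notin> ?D"
    then have "c 1 = 0" using is_queueD(4)[OF q sites(1) assms(5)] by simp
    then have "c n = 0" "1 \<notin> R"
      using c1(2) cn \<open>1 \<notin> ?D\<close> by (auto split: if_splits simp: of_bool_def)
    moreover have "c 2 = 0" using c2(3) \<open>c 1 = 0\<close> assms(6) by (simp add: of_bool_def)
    ultimately show "1 \<notin> R \<and> line_queue R B n = 0" using line by simp
  next
    assume *: "1 \<notin> R \<and> line_queue R B n = 0"
    then show "1 \<notin> ?D" using D assms(1) by (auto simp: pred_site_def)
  qed
qed

section \<open>Sums over two lines\<close>

lemma sum_two_lines: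
  fixes x :: "nat \<Rightarrow> real" and h :: "bool \<Rightarrow> bool \<Rightarrow> nat \<Rightarrow> real"
  assumes n: "2 \<le> n"
  shows "(\<Sum>R\<in>subsets n p. \<Sum>B\<in>subsets n q. prod x R * prod x B *
      of_bool (1 \<in> B \<and> 2 \<in> B \<and> P (1 \<in> R) (2 \<in> R) (line_queue R B n))) =
    x 1 * x 2 * (\<Sum>R\<in>Pow {3..n}. \<Sum>B\<in>Pow {3..n}. of_bool (int (card B) = int q - 2) * (prod x R * prod x B) *
      (of_bool (int (card R) = int p \<and> P False False (line_queue R B n))
      + x 1 * of_bool (int (card R) = int p - 1 \<and> P True False (line_queue R B n))
      + x 2 * of_bool (int (card R) = int p - 1 \<and> P False True (line_queue R B n))
      + x 1 * x 2 * of_bool (int (card R) = int p - 2 \<and> P True True (line_queue R B n))))"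
proof -
  let ?M = "{3..n}"
  have M: "finite ?M" "2 \<notin> ?M" "finite (insert 2 ?M)" "1 \<notin> insert 2 ?M" by auto
  let ?v = "\<lambda>R B. of_bool (card R = p) * (of_bool (card B = q) * (prod x R * prod x B *
      of_bool (1 \<in> B \<and> 2 \<in> B \<and> P (1 \<in> R) (2 \<in> R) (line_queue R B n))))"
  have "(\<Sum>R\<in>subsets n p. \<Sum>B\<in>subsets n q. prod x R * prod x B *
      of_bool (1 \<in> B \<and> 2 \<in> B \<and> P (1 \<in> R) (2 \<in> R) (line_queue R B n))) =
      (\<Sum>R\<in>Pow {1..n}. \<Sum>B\<in>Pow {1..n}. ?v R B)"
    by (simp only: sum_subsets sum_distrib_left)
  also have "\<dots> = (\<Sum>R\<in>Pow ?M. \<Sum>B\<in>Pow ?M. x 1 * x 2 * (of_bool (int (card B) = int q - 2) * (prod x R * prod x B) *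
      (of_bool (int (card R) = int p \<and> P False False (line_queue R B n))
      + x 1 * of_bool (int (card R) = int p - 1 \<and> P True False (line_queue R B n))
      + x 2 * of_bool (int (card R) = int p - 1 \<and> P False True (line_queue R B n))
      + x 1 * x 2 * of_bool (int (card R) = int p - 2 \<and> P True True (line_queue R B n)))))"
  proof -
    let ?i = "\<lambda>B :: nat set. insert 1 (insert 2 B)"
    have inner: "(\<Sum>B\<in>Pow {1..n}. ?v R B) = (\<Sum>B\<in>Pow ?M. ?v R (?i B))" for R
      unfolding sites_split[OF n] sum_Pow_insert2[OF M(1,2,4)]
    proof (intro sum.cong refl)
      fix B assume "B \<in> Pow ?M"
      then have "1 \<notin> B" "2 \<notin> B" by auto
      then show "?v R B + ?v R (insert 2 B) + (?v R (insert 1 B) + ?v R (?i B)) = ?v R (?i B)"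
        by simp
    qed
    have "(\<Sum>R\<in>Pow {1..n}. \<Sum>B\<in>Pow {1..n}. ?v R B) =
        (\<Sum>R\<in>Pow {1..n}. \<Sum>B\<in>Pow ?M. ?v R (?i B))" by (intro sum.cong refl inner)
    also have "\<dots> = (\<Sum>R\<in>Pow ?M. \<Sum>B\<in>Pow ?M. ?v R (?i B) + ?v (insert 2 R) (?i B)
        + (?v (insert 1 R) (?i B) + ?v (?i R) (?i B)))"
      unfolding sites_split[OF n] sum_Pow_insert2[OF M(1,2,4)] by (simp only: sum.distrib)
    also have "\<dots> = (\<Sum>R\<in>Pow ?M. \<Sum>B\<in>Pow ?M. x 1 * x 2 * (of_bool (int (card B) = int q - 2) * (prod x R * prod x B) *
      (of_bool (int (card R) = int p \<and> P False False (line_queue R B n))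
      + x 1 * of_bool (int (card R) = int p - 1 \<and> P True False (line_queue R B n))
      + x 2 * of_bool (int (card R) = int p - 1 \<and> P False True (line_queue R B n))
      + x 1 * x 2 * of_bool (int (card R) = int p - 2 \<and> P True True (line_queue R B n)))))"
    proof (intro sum.cong refl)
      fix R B assume RB: "R \<in> Pow ?M" "B \<in> Pow ?M"
      have R: "finite R" "1 \<notin> R" "2 \<notin> R" and B: "finite B" "1 \<notin> B" "2 \<notin> B"
        using RB finite_subset by auto
      have cong: "line_queue R' B' n = line_queue R B n"
        if "R' - {1, 2} = R" "B' - {1, 2} = B" for R' B'
        using that by (intro line_queue_cong) auto
      let ?B = "insert 1 (insert 2 B)" and ?L = "line_queue R B n"
      have q': "card ?B = q \<longleftrightarrow> int (card B) = int q - 2" using B by auto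
      have wB: "prod x ?B = x 1 * x 2 * prod x B" using B by simp
      have L: "line_queue R ?B n = ?L" "line_queue (insert 2 R) ?B n = ?L"
        "line_queue (insert 1 R) ?B n = ?L" "line_queue (insert 1 (insert 2 R)) ?B n = ?L"
        using R B by (auto intro!: cong)
      have 1: "?v R ?B = x 1 * x 2 * (of_bool (int (card B) = int q - 2) * (prod x R * prod x B) *
        of_bool (int (card R) = int p \<and> P False False ?L))"
        unfolding q' wB L using R by auto
      have 2: "?v (insert 2 R) ?B = x 1 * x 2 * (of_bool (int (card B) = int q - 2) * (prod x R * prod x B) *
        (x 2 * of_bool (int (card R) = int p - 1 \<and> P False True ?L)))"
        unfolding q' wB L using R by auto
      have 3: "?v (insert 1 R) ?B = x 1 * x 2 * (of_bool (int (card B) = int q - 2) * (prod x R * prod x B) *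
        (x 1 * of_bool (int (card R) = int p - 1 \<and> P True False ?L)))"
        unfolding q' wB L using R by auto
      have 4: "?v (insert 1 (insert 2 R)) ?B = x 1 * x 2 * (of_bool (int (card B) = int q - 2) * (prod x R * prod x B) *
        (x 1 * x 2 * of_bool (int (card R) = int p - 2 \<and> P True True ?L)))"
        unfolding q' wB L using R by auto
      show "?v R ?B + ?v (insert 2 R) ?B + (?v (insert 1 R) ?B + ?v (insert 1 (insert 2 R)) ?B) =
        x 1 * x 2 * (of_bool (int (card B) = int q - 2) * (prod x R * prod x B) *
        (of_bool (int (card R) = int p \<and> P False False ?L)
        + x 1 * of_bool (int (card R) = int p - 1 \<and> P True False ?L)
        + x 2 * of_bool (int (card R) = int p - 1 \<and> P False True ?L)
        + x 1 * x 2 * of_bool (int (card R) = int p - 2 \<and> P True True ?L)))"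
        unfolding 1 2 3 4 by (simp only: distrib_left add_ac)
      qed
      finally show ?thesis .
  qed
  finally show ?thesis by (simp only: sum_distrib_left)
qed

lemma sum_one_line:
  fixes x :: "nat \<Rightarrow> real"
  assumes n: "2 \<le> n"
  defines "E \<equiv> esym {3..n} x"
  shows "(\<Sum>B\<in>subsets n q. prod x B * of_bool (1 \<in> B \<and> 2 \<in> B)) = x 1 * x 2 * E (int q - 2)"
    and "(\<Sum>B\<in>subsets n q. prod x B * of_bool (1 \<in> B)) = x 1 * (E (int q - 1) + x 2 * E (int q - 2))"
    and "(\<Sum>B\<in>subsets n q. prod x B * of_bool (2 \<in> B)) = x 2 * (E (int q - 1) + x 1 * E (int q - 2))"
proof -
  let ?M = "{3..n}"
  have M: "finite ?M" "2 \<notin> ?M" "1 \<notin> insert 2 ?M" by auto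
  have mem: "finite B" "1 \<notin> B" "2 \<notin> B" if "B \<in> Pow ?M" for B
    using that finite_subset by auto
  note split = sum_subsets sites_split[OF n] sum_Pow_insert2[OF M]
  have "(\<Sum>B\<in>subsets n q. prod x B * of_bool (1 \<in> B \<and> 2 \<in> B)) =
      (\<Sum>B\<in>Pow ?M. x 1 * x 2 * (of_bool (int (card B) = int q - 2) * prod x B))"
    unfolding split by (intro sum.cong refl) (use mem in auto)
  then show "(\<Sum>B\<in>subsets n q. prod x B * of_bool (1 \<in> B \<and> 2 \<in> B)) = x 1 * x 2 * E (int q - 2)"
    by (simp only: E_def esym_def sum_distrib_left)
  have "(\<Sum>B\<in>subsets n q. prod x B * of_bool (1 \<in> B)) =
      (\<Sum>B\<in>Pow ?M. x 1 * (of_bool (int (card B) = int q - 1) * prod x B)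
        + x 1 * x 2 * (of_bool (int (card B) = int q - 2) * prod x B))"
    unfolding split by (intro sum.cong refl) (use mem in auto)
  also have "\<dots> = x 1 * E (int q - 1) + x 1 * x 2 * E (int q - 2)"
    by (simp only: E_def esym_def sum.distrib sum_distrib_left)
  finally show "(\<Sum>B\<in>subsets n q. prod x B * of_bool (1 \<in> B)) = x 1 * (E (int q - 1) + x 2 * E (int q - 2))"
    by (simp only: distrib_left mult.assoc)
  have "(\<Sum>B\<in>subsets n q. prod x B * of_bool (2 \<in> B)) =
      (\<Sum>B\<in>Pow ?M. x 2 * (of_bool (int (card B) = int q - 1) * prod x B)
        + x 2 * x 1 * (of_bool (int (card B) = int q - 2) * prod x B))"
    unfolding split by (intro sum.cong refl) (use mem in auto)
  also have "\<dots> = x 2 * E (int q - 1) + x 2 * x 1 * E (int q - 2)"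
    by (simp only: E_def esym_def sum.distrib sum_distrib_left)
  finally show "(\<Sum>B\<in>subsets n q. prod x B * of_bool (2 \<in> B)) = x 2 * (E (int q - 1) + x 1 * E (int q - 2))"
    by (simp only: distrib_left mult.assoc)
qed

text \<open>In the first sum the service at 1 may absorb one customer: one left over from the line
  (bound 1) or one arriving at 1 (bound 0, factor \<open>x 1\<close>). In the second it must stay
  idle, while an arrival at 2 is allowed.\<close>

lemma sum_unused:
  fixes x :: "nat \<Rightarrow> real"
  assumes n: "2 \<le> n"
  shows "(\<Sum>R\<in>subsets n p. \<Sum>B\<in>subsets n q. prod x R * prod x B *
      of_bool (1 \<in> B \<and> 2 \<in> B \<and> (2 \<notin> R \<and> line_queue R B n + of_bool (1 \<in> R) \<le> 1))) =
      x 1 * x 2 * (line_sum x n (int p) (int q - 2) 1 + x 1 * line_sum x n (int p - 1) (int q - 2) 0)"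
    and "(\<Sum>R\<in>subsets n p. \<Sum>B\<in>subsets n q. prod x R * prod x B *
      of_bool (1 \<in> B \<and> 2 \<in> B \<and> (1 \<notin> R \<and> line_queue R B n = 0))) =
      x 1 * x 2 * (line_sum x n (int p) (int q - 2) 0 + x 2 * line_sum x n (int p - 1) (int q - 2) 0)"
proof -
  let ?\<Sigma> = "\<lambda>f :: nat set \<Rightarrow> nat set \<Rightarrow> real. \<Sum>R\<in>Pow {3..n}. \<Sum>B\<in>Pow {3..n}. f R B"
  let ?w = "\<lambda>a C R B. of_bool (int (card R) = a \<and> int (card B) = int q - 2 \<and> int (line_queue R B n) \<le> C)
    * (prod x R * prod x B)"
  have collect: "?\<Sigma> (\<lambda>R B. ?w (int p) C R B + z * ?w (int p - 1) 0 R B) =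
      line_sum x n (int p) (int q - 2) C + z * line_sum x n (int p - 1) (int q - 2) 0" for C z
    by (simp only: line_sum_def sum.distrib sum_distrib_left)
  show "(\<Sum>R\<in>subsets n p. \<Sum>B\<in>subsets n q. prod x R * prod x B *
      of_bool (1 \<in> B \<and> 2 \<in> B \<and> (2 \<notin> R \<and> line_queue R B n + of_bool (1 \<in> R) \<le> 1))) =
      x 1 * x 2 * (line_sum x n (int p) (int q - 2) 1 + x 1 * line_sum x n (int p - 1) (int q - 2) 0)"
    unfolding sum_two_lines[OF n, where P="\<lambda>r1 r2 L. \<not> r2 \<and> L + of_bool r1 \<le> 1"] collect[symmetric]
    by (intro arg_cong2[where f="(*)"] sum.cong refl) auto
  show "(\<Sum>R\<in>subsets n p. \<Sum>B\<in>subsets n q. prod x R * prod x B *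
      of_bool (1 \<in> B \<and> 2 \<in> B \<and> (1 \<notin> R \<and> line_queue R B n = 0))) =
      x 1 * x 2 * (line_sum x n (int p) (int q - 2) 0 + x 2 * line_sum x n (int p - 1) (int q - 2) 0)"
    unfolding sum_two_lines[OF n, where P="\<lambda>r1 r2 L. \<not> r1 \<and> L = 0"] collect[symmetric]
    by (intro arg_cong2[where f="(*)"] sum.cong refl) auto
qed

lemma sum_departures:
  fixes x :: "nat \<Rightarrow> real"
  assumes n: "2 \<le> n" and pq: "p < q"
  defines "E \<equiv> esym {3..n} x" and "P \<equiv> int p" and "Q \<equiv> int q"
  shows "(\<Sum>R\<in>subsets n p. \<Sum>B\<in>subsets n q. prod x R * prod x B *
      of_bool (1 \<in> B \<and> 2 \<in> departures n R B)) =
      x 1 * x 2 * (E (Q - 2) * (x 2 * E (P - 1) + x 1 * x 2 * E (P - 2)) + E Q * E (P - 2)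
        + x 1 * E (Q - 1) * E (P - 2))"
    and "(\<Sum>R\<in>subsets n p. \<Sum>B\<in>subsets n q. prod x R * prod x B *
      of_bool (1 \<in> departures n R B \<and> 2 \<in> B)) =
      x 1 * x 2 * ((E (Q - 1) + x 1 * E (Q - 2)) * (E (P - 1) + x 2 * E (P - 2)))"
proof -
  let ?\<Sigma> = "\<lambda>f :: nat set \<Rightarrow> nat set \<Rightarrow> bool. \<Sum>R\<in>subsets n p. \<Sum>B\<in>subsets n q. prod x R * prod x B * of_bool (f R B)"
  have RB: "R \<subseteq> {1..n}" "B \<subseteq> {1..n}" "card R < card B"
    if "R \<in> subsets n p" "B \<in> subsets n q" for R B
    using that pq by (auto simp: subsets_def)
  have all: "?\<Sigma> (\<lambda>R B. 1 \<in> B \<and> 2 \<in> B) =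
      (E P + (x 1 + x 2) * E (P - 1) + x 1 * x 2 * E (P - 2)) * (x 1 * x 2 * E (Q - 2))"
  proof -
    have "?\<Sigma> (\<lambda>R B. 1 \<in> B \<and> 2 \<in> B) =
        (\<Sum>R\<in>subsets n p. prod x R) * (\<Sum>B\<in>subsets n q. prod x B * of_bool (1 \<in> B \<and> 2 \<in> B))"
      by (simp only: sum_product mult.assoc)
    then show ?thesis
      unfolding sum_one_line(1)[OF n] elem_sym_eq[symmetric] elem_sym_esym esym_sites[OF n]
      by (simp add: E_def P_def Q_def)
  qed
  have "?\<Sigma> (\<lambda>R B. 1 \<in> B \<and> 2 \<in> departures n R B) = ?\<Sigma> (\<lambda>R B. 1 \<in> B \<and> 2 \<in> B)
      - ?\<Sigma> (\<lambda>R B. 1 \<in> B \<and> 2 \<in> B \<and> (2 \<notin> R \<and> line_queue R B n + of_bool (1 \<in> R) \<le> 1))"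
    unfolding sum_subtractf[symmetric]
  proof (intro sum.cong refl)
    fix R B assume "R \<in> subsets n p" "B \<in> subsets n q"
    note RB = RB[OF this]
    show "prod x R * prod x B * of_bool (1 \<in> B \<and> 2 \<in> departures n R B) =
      prod x R * prod x B * of_bool (1 \<in> B \<and> 2 \<in> B) - prod x R * prod x B *
      of_bool (1 \<in> B \<and> 2 \<in> B \<and> (2 \<notin> R \<and> line_queue R B n + of_bool (1 \<in> R) \<le> 1))"
      using departures_subset[OF RB] departures_cut(1)[OF n RB]
      by (cases "1 \<in> B"; cases "2 \<in> B"; cases "2 \<in> departures n R B") auto
  qed
  then show "?\<Sigma> (\<lambda>R B. 1 \<in> B \<and> 2 \<in> departures n R B) =
      x 1 * x 2 * (E (Q - 2) * (x 2 * E (P - 1) + x 1 * x 2 * E (P - 2)) + E Q * E (P - 2)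
        + x 1 * E (Q - 1) * E (P - 2))"
    unfolding all sum_unused[OF n] using n pq
    by (simp add: line_sum_eq E_def P_def Q_def algebra_simps)
  have "?\<Sigma> (\<lambda>R B. 1 \<in> departures n R B \<and> 2 \<in> B) = ?\<Sigma> (\<lambda>R B. 1 \<in> B \<and> 2 \<in> B)
      - ?\<Sigma> (\<lambda>R B. 1 \<in> B \<and> 2 \<in> B \<and> (1 \<notin> R \<and> line_queue R B n = 0))"
    unfolding sum_subtractf[symmetric]
  proof (intro sum.cong refl)
    fix R B assume "R \<in> subsets n p" "B \<in> subsets n q"
    note RB = RB[OF this]
    show "prod x R * prod x B * of_bool (1 \<in> departures n R B \<and> 2 \<in> B) =
      prod x R * prod x B * of_bool (1 \<in> B \<and> 2 \<in> B) - prod x R * prod x B *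
      of_bool (1 \<in> B \<and> 2 \<in> B \<and> (1 \<notin> R \<and> line_queue R B n = 0))"
      using departures_subset[OF RB] departures_cut(2)[OF n RB]
      by (cases "1 \<in> B"; cases "2 \<in> B"; cases "1 \<in> departures n R B") auto
  qed
  \<comment> \<open>Here \<open>line_sum_eq\<close> is applied with \<open>a = P\<close>,
    \<open>b = Q - 2\<close>, \<open>C = 0\<close>; its condition on \<open>a\<close> is exactly
    \<open>p < q\<close>.\<close>
  then show "?\<Sigma> (\<lambda>R B. 1 \<in> departures n R B \<and> 2 \<in> B) =
      x 1 * x 2 * ((E (Q - 1) + x 1 * E (Q - 2)) * (E (P - 1) + x 2 * E (P - 2)))"
    unfolding all sum_unused[OF n] using n pq
    by (simp add: line_sum_eq E_def P_def Q_def algebra_simps)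
qed

section \<open>Two-site probabilities of the level sets\<close>

definition level_prob :: "nat \<Rightarrow> (nat \<Rightarrow> nat) pmf \<Rightarrow> nat \<Rightarrow> nat \<Rightarrow> real" where
  "level_prob n \<pi> t u = (\<Sum>\<eta>\<in>configs n. pmf \<pi> \<eta> * of_bool (1 \<in> level n t \<eta> \<and> 2 \<in> level n u \<eta>))"

text \<open>Threshold \<open>n\<close> gives an empty upper level and an empty arrival line of
  weight 1.\<close>

lemma single_law:
  fixes x :: "nat \<Rightarrow> real"
  assumes \<pi>: "stationary n x \<pi>" and x: "\<And>k. k \<in> {1..n} \<Longrightarrow> 0 < x k" and t: "0 < t" "t < n"
  shows "(\<Sum>\<eta>\<in>configs n. pmf \<pi> \<eta> * g (level n t \<eta>)) =
    (\<Sum>B\<in>subsets n (n - t). prod x B * g B) / elem_sym n x (n - t)"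
proof -
  have "elem_sym n x (n - n) \<noteq> 0" using elem_sym_pos[of n x 0] x by simp
  moreover have "(\<Sum>R\<in>subsets n (n - n). \<Sum>B\<in>subsets n (n - t). prod x R * prod x B * g B) =
      elem_sym n x (n - n) * (\<Sum>B\<in>subsets n (n - t). prod x B * g B)"
    by (simp only: elem_sym_eq sum_product mult.assoc)
  ultimately show ?thesis
    using pair_law[OF \<pi> x t order_refl, where g="\<lambda>_. g"] by simp
qed

context
  fixes n :: nat and x :: "nat \<Rightarrow> real" and \<pi> :: "(nat \<Rightarrow> nat) pmf"
    and E :: "int \<Rightarrow> real" and e :: "int \<Rightarrow> real"
  assumes n: "2 \<le> n" and rates_pos: "\<forall>k\<in>{1..n}. 0 < x k" and \<pi>: "stationary n x \<pi>"
  defines "E \<equiv> esym {3..n} x" and "e \<equiv> \<lambda>k. E k + (x 1 + x 2) * E (k - 1) + x 1 * x 2 * E (k - 2)"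
begin

lemma rate_pos: "k \<in> {1..n} \<Longrightarrow> 0 < x k"
  using rates_pos by blast

lemma elem_sym_rec: "k \<le> n \<Longrightarrow> elem_sym n x (n - k) = e (int n - int k)"
  unfolding elem_sym_esym esym_sites[OF n] e_def E_def by (simp add: of_nat_diff)

lemma rec_pos: "k \<le> n \<Longrightarrow> 0 < e (int n - int k)"
  using elem_sym_pos[of n x "n - k"] rate_pos by (simp add: elem_sym_rec)

lemma E_large: "int n - 2 < k \<Longrightarrow> E k = 0"
proof -
  assume k: "int n - 2 < k"
  have "int (card S) \<noteq> k" if "S \<in> Pow {3..n}" for S
    using card_mono[of "{3..n}" S] that k n by auto
  then show ?thesis unfolding E_def esym_def by (intro sum.neutral) auto
qed

lemma level_prob_same:
  assumes "t \<le> n"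
  defines "p \<equiv> int n - int t"
  shows "level_prob n \<pi> t t = x 1 * x 2 * E (p - 2) / e p"
proof -
  consider "t = 0" | "t = n" | "0 < t" "t < n" using assms by linarith
  then show ?thesis
  proof cases
    case 1
    then have "level_prob n \<pi> t t = 1"
      using n by (simp add: level_prob_def level_0 sum_pmf_configs[OF \<pi>])
    moreover have "e p = x 1 * x 2 * E (p - 2)"
      using 1 by (simp add: e_def p_def E_large)
    then have "x 1 * x 2 * E (p - 2) / e p = e p / e p" by (simp only:)
    moreover have "0 < e p" unfolding p_def by (rule rec_pos[OF assms(1)])
    ultimately show ?thesis by (metis divide_self less_irrefl)
  next
    case 2
    then have "level_prob n \<pi> t t = 0"
      by (simp add: level_prob_def level_n)
    then show ?thesis using 2 by (simp add: p_def E_def esym_neg)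
  next
    case 3
    then show ?thesis
      using single_law[OF \<pi> rate_pos 3, where g="\<lambda>B. of_bool (1 \<in> B \<and> 2 \<in> B)"] sum_one_line(1)[OF n, of x "n - t"]
      by (simp add: level_prob_def elem_sym_rec p_def E_def of_nat_diff)
  qed
qed

text \<open>One formula must serve all threshold pairs of a second difference, including equal ones,
  where a factor \<open>e p\<close> cancels, and the thresholds \<open>0\<close> and
  \<open>n\<close>, which are outside the queue law and hold since \<open>E\<close> vanishes outside
  degrees \<open>0\<close> to \<open>n - 2\<close>.\<close>

lemma level_prob_le:
  assumes "t \<le> u" "u \<le> n"
  defines "p \<equiv> int n - int u" and "q \<equiv> int n - int t"
  shows "level_prob n \<pi> t u = x 1 * x 2 * (E (q - 2) * (x 2 * E (p - 1) + x 1 * x 2 * E (p - 2))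
    + E q * E (p - 2) + x 1 * E (q - 1) * E (p - 2)) / (e p * e q)"
proof -
  have pos: "0 < e p" "0 < e q" using rec_pos assms by auto
  consider "t = u" | "t = 0" "t < u" "u = n" | "t = 0" "0 < u" "u < n" | "0 < t" "t < u"
    using assms by linarith
  then show ?thesis
  proof cases
    case 1
    then have "E (q - 2) * (x 2 * E (p - 1) + x 1 * x 2 * E (p - 2))
        + E q * E (p - 2) + x 1 * E (q - 1) * E (p - 2) = E (p - 2) * e p"
      by (simp add: p_def q_def e_def algebra_simps)
    then show ?thesis
      using 1 level_prob_same[of t] assms(2) pos by (simp add: p_def q_def)
  next
    case 2
    then have "level_prob n \<pi> t u = 0"
      by (simp add: level_prob_def level_n)
    then show ?thesis using 2 by (simp add: p_def E_def esym_neg)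
  next
    case 3
    have "level_prob n \<pi> t u = (\<Sum>\<eta>\<in>configs n. pmf \<pi> \<eta> * of_bool (2 \<in> level n u \<eta>))"
      using 3 n by (simp add: level_prob_def level_0)
    also have "\<dots> = x 2 * (E (p - 1) + x 1 * E (p - 2)) / e p"
      using single_law[OF \<pi> rate_pos 3(2,3), where g="\<lambda>B. of_bool (2 \<in> B)"] sum_one_line(3)[OF n, of x "n - u"] 3
      by (simp add: elem_sym_rec p_def E_def of_nat_diff)
    also have "\<dots> = x 1 * x 2 * (E (q - 2) * (x 2 * E (p - 1) + x 1 * x 2 * E (p - 2))) / (e p * e q)"
    proof -
      have "e q = x 1 * x 2 * E (q - 2)" using 3 by (simp add: e_def q_def E_large)
      then have "x 2 * (E (p - 1) + x 1 * E (p - 2)) * e q =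
          x 1 * x 2 * (E (q - 2) * (x 2 * E (p - 1) + x 1 * x 2 * E (p - 2)))"
        by (simp add: algebra_simps)
      moreover have "x 2 * (E (p - 1) + x 1 * E (p - 2)) / e p =
          x 2 * (E (p - 1) + x 1 * E (p - 2)) * e q / (e p * e q)"
        using pos by simp
      ultimately show ?thesis by (simp only:)
    qed
    also have "\<dots> = x 1 * x 2 * (E (q - 2) * (x 2 * E (p - 1) + x 1 * x 2 * E (p - 2))
      + E q * E (p - 2) + x 1 * E (q - 1) * E (p - 2)) / (e p * e q)"
      using 3 by (simp add: q_def E_large)
    finally show ?thesis .
  next
    case 4
    then show ?thesis
      using pair_law[OF \<pi> rate_pos 4 assms(2), where g="\<lambda>A B. of_bool (1 \<in> B \<and> 2 \<in> A)"]
        sum_departures(1)[OF n, of "n - u" "n - t" x] assms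
      by (simp add: level_prob_def elem_sym_rec p_def q_def E_def of_nat_diff)
  qed
qed

text \<open>The factors are the two one-site probabilities; at \<open>u = 0\<close> the second is 1,
  at \<open>t = n\<close> the first is 0.\<close>

lemma level_prob_less:
  assumes "u < t" "t \<le> n"
  defines "p \<equiv> int n - int t" and "q \<equiv> int n - int u"
  shows "level_prob n \<pi> t u =
    (x 1 * (E (p - 1) + x 2 * E (p - 2)) / e p) * (x 2 * (E (q - 1) + x 1 * E (q - 2)) / e q)"
proof -
  have pos: "0 < e p" "0 < e q" using rec_pos assms by auto
  consider "u = 0" "t = n" | "u = 0" "0 < t" "t < n" | "0 < u" using assms by linarith
  then show ?thesis
  proof cases
    case 1
    then have "level_prob n \<pi> t u = 0"
      by (simp add: level_prob_def level_n)
    then show ?thesis using 1 by (simp add: p_def E_def esym_neg)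
  next
    case 2
    have "level_prob n \<pi> t u = (\<Sum>\<eta>\<in>configs n. pmf \<pi> \<eta> * of_bool (1 \<in> level n t \<eta>))"
      using 2 n by (simp add: level_prob_def level_0)
    also have "\<dots> = x 1 * (E (p - 1) + x 2 * E (p - 2)) / e p"
      using single_law[OF \<pi> rate_pos 2(2,3), where g="\<lambda>B. of_bool (1 \<in> B)"] sum_one_line(2)[OF n, of x "n - t"] 2
      by (simp add: elem_sym_rec p_def E_def of_nat_diff)
    moreover have "x 2 * (E (q - 1) + x 1 * E (q - 2)) = e q"
      using 2 by (simp add: e_def q_def E_large)
    ultimately show ?thesis using pos by simp
  next
    case 3
    then show ?thesis
      using pair_law[OF \<pi> rate_pos 3 assms(1,2), where g="\<lambda>A B. of_bool (1 \<in> A \<and> 2 \<in> B)"]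
        sum_departures(2)[OF n, of "n - t" "n - u" x] assms
      by (simp add: level_prob_def elem_sym_rec p_def q_def E_def of_nat_diff mult_ac)
  qed
qed

end

section \<open>Schur polynomials in terms of elementary symmetric polynomials\<close>

lemma eval_elem_mpoly:
  assumes "2 \<le> n"
  shows "eval_mpoly (\<lambda>i. xs_from3 n x ! i) (elem_mpoly (length (xs_from3 n x)) b) = esym {3..n} x (int b)"
proof -
  have len: "length (xs_from3 n x) = n - 2" using assms by (simp add: xs_from3_def del: upt_Suc)
  have shift: "bij_betw ((+) 3) {..<n - 2} {3..n}"
    using assms by (intro bij_betwI[where g="\<lambda>s. s - 3"]) auto
  have "eval_mpoly (\<lambda>i. xs_from3 n x ! i) (elem_mpoly (n - 2) b) =
      (\<Sum>S | S \<subseteq> {..<n - 2} \<and> card S = b. \<Prod>i\<in>S. x (3 + i))"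
    unfolding elem_mpoly_def eval_mpoly_sum eval_mpoly_prod eval_mpoly_var
    by (intro sum.cong prod.cong refl) (auto simp: xs_from3_def nth_append simp del: upt_Suc)
  also have "\<dots> = (\<Sum>S\<in>Pow {..<n - 2}. of_bool (int (card ((+) 3 ` S)) = int b) * prod x ((+) 3 ` S))"
    by (intro sum.mono_neutral_cong_left) (auto simp: card_image prod.reindex)
  also have "\<dots> = esym {3..n} x (int b)"
    unfolding esym_def by (rule sum.reindex_bij_betw[OF bij_betw_Pow[OF shift]])
  finally show ?thesis unfolding len .
qed

text \<open>The integer degrees absorb the conventions: for \<open>m < 0\<close> each product has a
  factor of negative degree, and for \<open>m = 0\<close> the second one has.\<close>

lemma schur12_eq:
  fixes x :: "nat \<Rightarrow> real"
  assumes "2 \<le> n" "k \<le> 1"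
  defines "E \<equiv> esym {3..n} x"
  shows "schur12 k m (xs_from3 n x) = E (m + int k) * E m - E (m + int k + 1) * E (m - 1)"
proof (cases "m < 0")
  case True
  then show ?thesis using assms(2) by (simp add: schur12_def E_def esym_neg)
next
  case False
  define l where "l = nat m"
  have l: "m = int l" using False by (simp add: l_def)
  have "E (int (l + k)) * E (int l) - (if l = 0 then 0 else E (int (l - 1)) * E (int (l + k + 1))) =
      E (m + int k) * E m - E (m + int k + 1) * E (m - 1)"
    by (cases l) (simp_all add: l E_def esym_neg add_ac)
  moreover have "schur12 k m (xs_from3 n x) =
      E (int (l + k)) * E (int l) - (if l = 0 then 0 else E (int (l - 1)) * E (int (l + k + 1)))"
    using False unfolding schur12_def l
    by (simp add: schur_two_columns eval_mpoly_diff eval_mpoly_mult eval_elem_mpoly[OF assms(1)] E_def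
        del: One_nat_def)
  ultimately show ?thesis by simp
qed

section \<open>Expansion of the determinant and the double sum of the theorem\<close>

lemma det_2:
  fixes A :: "'a :: comm_ring_1 mat"
  assumes "A \<in> carrier_mat 2 2"
  shows "Determinant.det A = A $$ (0, 0) * A $$ (1, 1) - A $$ (0, 1) * A $$ (1, 0)"
proof -
  have carrier: "mat_delete A 0 j \<in> carrier_mat 1 1" for j
    using mat_delete_carrier[OF assms, of 0 j] by simp
  show ?thesis
    unfolding laplace_expansion_row[OF assms, of 0, simplified] cofactor_def det_single[OF carrier]
    using assms by (simp add: mat_delete_def numeral_2_eq_2)
qed

lemma det_3:
  fixes A :: "'a :: comm_ring_1 mat"
  assumes "A \<in> carrier_mat 3 3"
  shows "Determinant.det A =
    A $$ (0, 0) * (A $$ (1, 1) * A $$ (2, 2) - A $$ (1, 2) * A $$ (2, 1))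
    - A $$ (0, 1) * (A $$ (1, 0) * A $$ (2, 2) - A $$ (1, 2) * A $$ (2, 0))
    + A $$ (0, 2) * (A $$ (1, 0) * A $$ (2, 1) - A $$ (1, 1) * A $$ (2, 0))"
proof -
  have carrier: "mat_delete A 0 j \<in> carrier_mat 2 2" for j
    using mat_delete_carrier[OF assms, of 0 j] by simp
  show ?thesis
    unfolding laplace_expansion_row[OF assms, of 0, simplified] cofactor_def det_2[OF carrier]
    using assms by (simp add: mat_delete_def numeral_3_eq_3 numeral_2_eq_2 algebra_simps)
qed


lemma det_rows_3:
  fixes a :: "'a :: comm_ring_1"
  shows "Determinant.det (mat_of_rows_list 3 [[a, b, c], [d, e, f], [g, h, i]]) =
    a * (e * i - f * h) - b * (d * i - f * g) + c * (d * h - e * g)"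
  by (subst det_3) (simp_all add: mat_of_rows_list_def numeral_2_eq_2 numeral_3_eq_3)

lemma f_fun_eq:
  "f_fun n j i x = (let \<sigma> = \<lambda>m. schur12 0 m (xs_from3 n x); \<tau> = \<lambda>m. schur12 1 m (xs_from3 n x);
      J = int n - int j; I = int n - int i in
    \<tau> (J - 2) * \<sigma> (I - 1) - \<tau> (I - 2) * \<sigma> (J - 1)
    + \<sigma> (J - 2) * ((x 1 + x 2) * \<sigma> (I - 1) + x 1 * x 2 * \<tau> (I - 2))
    - \<sigma> (I - 2) * ((x 1 + x 2) * \<sigma> (J - 1) + x 1 * x 2 * \<tau> (J - 2)))"
  unfolding f_fun_def Let_def det_rows_3 by (simp add: algebra_simps)

lemma g_fun_eq:
  "g_fun n j i x = (let \<sigma> = \<lambda>m. schur12 0 m (xs_from3 n x); \<tau> = \<lambda>m. schur12 1 m (xs_from3 n x);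
      J = int n - int j; I = int n - int i in
    x 1 * (x 1 ^ 2 * \<sigma> (I - 2) + x 1 * \<tau> (I - 2) + \<sigma> (I - 1))
    * (x 2 * (x 2 ^ 2 * \<sigma> (J - 2) + x 2 * \<tau> (J - 2) + \<sigma> (J - 1))))"
proof -
  have "{0..2::nat} = {0, 1, 2}" by auto
  then show ?thesis
    by (simp add: g_fun_def Let_def schur2a_def power2_eq_square power3_eq_cube algebra_simps)
qed

section \<open>Second differences of the level probabilities\<close>

context
  fixes E :: "int \<Rightarrow> real" and a b :: real and e \<sigma> \<tau> :: "int \<Rightarrow> real"
  assumes e: "\<And>k. e k = E k + (a + b) * E (k - 1) + a * b * E (k - 2)"
    and \<sigma>: "\<And>m. \<sigma> m = E m * E m - E (m + 1) * E (m - 1)"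
    and \<tau>: "\<And>m. \<tau> m = E (m + 1) * E m - E (m + 2) * E (m - 1)"
begin

text \<open>These are the numerators of the differences in \<open>k\<close> of
  \<open>E k / e k\<close>, \<open>E (k - 1) / e k\<close> and \<open>E (k - 2) / e k\<close>.
  Expanding \<open>e\<close> leaves antisymmetric combinations of products of \<open>E\<close>, that
  is, two-column Schur polynomials.\<close>

lemma column_minors:
  "E k * e (k - 1) - E (k - 1) * e k = - (a + b) * \<sigma> (k - 1) - a * b * \<tau> (k - 2)"
  "E (k - 1) * e (k - 1) - E (k - 2) * e k = \<sigma> (k - 1) - a * b * \<sigma> (k - 2)"
  "E (k - 2) * e (k - 1) - E (k - 3) * e k = \<tau> (k - 2) + (a + b) * \<sigma> (k - 2)"
  by (simp_all add: e \<sigma> \<tau> algebra_simps)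

lemma line_difference:
  "(E (k - 1) + b * E (k - 2)) * e (k - 1) - (E (k - 2) + b * E (k - 3)) * e k =
    b ^ 2 * \<sigma> (k - 2) + b * \<tau> (k - 2) + \<sigma> (k - 1)"
proof -
  have "(E (k - 1) + b * E (k - 2)) * e (k - 1) - (E (k - 2) + b * E (k - 3)) * e k =
      (E (k - 1) * e (k - 1) - E (k - 2) * e k) + b * (E (k - 2) * e (k - 1) - E (k - 3) * e k)"
    by (simp add: algebra_simps)
  then show ?thesis unfolding column_minors by (simp add: power2_eq_square algebra_simps)
qed

text \<open>\<open>N q p\<close> is bilinear in the values of \<open>E\<close> near \<open>q\<close>
  and near \<open>p\<close>, so its second difference is the same bilinear form in the minors of
  \<open>column_minors\<close>.\<close>

lemma queue_difference:
  fixes J I :: int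
  defines "N \<equiv> \<lambda>q p. E (q - 2) * (b * E (p - 1) + a * b * E (p - 2)) + E q * E (p - 2) + a * E (q - 1) * E (p - 2)"
  shows "N J I * (e (I - 1) * e (J - 1)) - N (J - 1) I * (e (I - 1) * e J)
      - N J (I - 1) * (e I * e (J - 1)) + N (J - 1) (I - 1) * (e I * e J) =
    b * (\<tau> (J - 2) * \<sigma> (I - 1) - \<tau> (I - 2) * \<sigma> (J - 1)
    + \<sigma> (J - 2) * ((a + b) * \<sigma> (I - 1) + a * b * \<tau> (I - 2))
    - \<sigma> (I - 2) * ((a + b) * \<sigma> (J - 1) + a * b * \<tau> (J - 2)))"
proof -
  let ?M0 = "\<lambda>k. E k * e (k - 1) - E (k - 1) * e k"
    and ?M1 = "\<lambda>k. E (k - 1) * e (k - 1) - E (k - 2) * e k"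
    and ?M2 = "\<lambda>k. E (k - 2) * e (k - 1) - E (k - 3) * e k"
  have "N J I * (e (I - 1) * e (J - 1)) - N (J - 1) I * (e (I - 1) * e J)
      - N J (I - 1) * (e I * e (J - 1)) + N (J - 1) (I - 1) * (e I * e J) =
    ?M2 J * (b * ?M1 I + a * b * ?M2 I) + ?M0 J * ?M2 I + a * ?M1 J * ?M2 I"
    by (simp add: N_def algebra_simps)
  then show ?thesis unfolding column_minors by (simp add: algebra_simps)
qed

end

section \<open>From level probabilities to the two-point function\<close>

lemma expectation_occ:
  fixes \<pi> :: "(nat \<Rightarrow> nat) pmf"
  assumes "2 \<le> n" "stationary n x \<pi>"
  shows "measure_pmf.expectation \<pi> (\<lambda>\<eta>. occ j 1 \<eta> * occ i 2 \<eta>) =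
    level_prob n \<pi> j i - level_prob n \<pi> (Suc j) i - level_prob n \<pi> j (Suc i)
    + level_prob n \<pi> (Suc j) (Suc i)"
proof -
  have "measure_pmf.expectation \<pi> (\<lambda>\<eta>. occ j 1 \<eta> * occ i 2 \<eta>) =
      (\<Sum>\<eta>\<in>configs n. occ j 1 \<eta> * occ i 2 \<eta> * pmf \<pi> \<eta>)"
    using assms(2) finite_configs by (intro integral_measure_pmf_real) (auto simp: stationary_def)
  also have "\<dots> = level_prob n \<pi> j i - level_prob n \<pi> (Suc j) i - level_prob n \<pi> j (Suc i)
    + level_prob n \<pi> (Suc j) (Suc i)"
    unfolding level_prob_def sum_subtractf[symmetric] sum.distrib[symmetric]
  proof (intro sum.cong refl)
    fix \<eta> :: "nat \<Rightarrow> nat"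
    have lev: "1 \<in> level n t \<eta> \<longleftrightarrow> t \<le> \<eta> 1" "2 \<in> level n t \<eta> \<longleftrightarrow> t \<le> \<eta> 2" for t
      using assms(1) by (auto simp: level_def)
    have occ: "occ j 1 \<eta> = of_bool (j \<le> \<eta> 1) - of_bool (Suc j \<le> \<eta> 1)"
      "occ i 2 \<eta> = of_bool (i \<le> \<eta> 2) - of_bool (Suc i \<le> \<eta> 2)"
      by (auto simp: occ_def)
    show "occ j 1 \<eta> * occ i 2 \<eta> * pmf \<pi> \<eta> =
        pmf \<pi> \<eta> * of_bool (1 \<in> level n j \<eta> \<and> 2 \<in> level n i \<eta>)
        - pmf \<pi> \<eta> * of_bool (1 \<in> level n (Suc j) \<eta> \<and> 2 \<in> level n i \<eta>)
        - pmf \<pi> \<eta> * of_bool (1 \<in> level n j \<eta> \<and> 2 \<in> level n (Suc i) \<eta>)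
        + pmf \<pi> \<eta> * of_bool (1 \<in> level n (Suc j) \<eta> \<and> 2 \<in> level n (Suc i) \<eta>)"
      unfolding lev of_bool_conj occ by (simp only: algebra_simps)
  qed
  finally show ?thesis .
qed

lemma expectation_occ_same:
  assumes "2 \<le> n" "stationary n x \<pi>"
  shows "measure_pmf.expectation \<pi> (\<lambda>\<eta>. occ i 1 \<eta> * occ i 2 \<eta>) = 0"
proof -
  have "measure_pmf.expectation \<pi> (\<lambda>\<eta>. occ i 1 \<eta> * occ i 2 \<eta>) = measure_pmf.expectation \<pi> (\<lambda>_. 0)"
  proof (intro integral_cong_AE AE_pmfI)
    fix \<eta> assume "\<eta> \<in> set_pmf \<pi>"
    then have "inj_on \<eta> {1..n}"
      using assms(2) by (auto simp: stationary_def configs_def bij_betw_def)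
    then have "\<eta> 1 \<noteq> \<eta> 2" using assms(1) by (auto dest: inj_onD[of _ _ 1 2])
    then show "occ i 1 \<eta> * occ i 2 \<eta> = 0" by (simp add: occ_def)
  qed auto
  then show ?thesis by simp
qed

theorem theorem3:
  fixes n i j :: nat and x :: "nat \<Rightarrow> real" and \<pi> :: "(nat \<Rightarrow> nat) pmf"
  assumes "n \<ge> 2"
    and "\<And>k. k \<in> {1..n} \<Longrightarrow> x k > 0"
    and "stationary n x \<pi>"
    and "i \<le> n - 1" and "j \<le> n - 1"
  shows "let P = measure_pmf.expectation \<pi> (\<lambda>\<eta>. occ j 1 \<eta> * occ i 2 \<eta>) in
         (j < i \<longrightarrow>
            P = x 1 * x 2 ^ 2 *
                (f_fun n j i x / elem_sym_list n x [n - j, n - j - 1, n - i, n - i - 1]))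
       \<and> (j = i \<longrightarrow> P = 0)
       \<and> (j = i + 1 \<longrightarrow>
            P = g_fun n (i + 1) i x / elem_sym_list n x [n - i, n - i - 1, n - i - 1, n - i - 2]
              + x 1 * x 2 * (schur12 0 (int n - int j - 1) (xs_from3 n x)
                             / elem_sym_list n x [n - j, n - j]))
       \<and> (j > i + 1 \<longrightarrow>
            P = g_fun n j i x / elem_sym_list n x [n - i, n - i - 1, n - j, n - j - 1])"
proof -
  define E where "E = esym {3..n} x"
  define e where "e = (\<lambda>k. E k + (x 1 + x 2) * E (k - 1) + x 1 * x 2 * E (k - 2))"
  define \<sigma> where "\<sigma> = (\<lambda>m. E m * E m - E (m + 1) * E (m - 1))"
  define \<tau> where "\<tau> = (\<lambda>m. E (m + 1) * E m - E (m + 2) * E (m - 1))"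
  define J I where "J = int n - int j" and "I = int n - int i"
  let ?P = "measure_pmf.expectation \<pi> (\<lambda>\<eta>. occ j 1 \<eta> * occ i 2 \<eta>)"
  note n = assms(1) and \<pi> = assms(3)
  have x: "\<forall>k\<in>{1..n}. 0 < x k" using assms(2) by blast
  have ji: "j \<le> n" "Suc j \<le> n" "i \<le> n" "Suc i \<le> n" using assms by auto
  have schur: "schur12 0 m (xs_from3 n x) = \<sigma> m" "schur12 1 m (xs_from3 n x) = \<tau> m" for m
    using schur12_eq[OF n, of 0 m x] schur12_eq[OF n, of 1 m x]
    by (simp_all add: \<sigma>_def \<tau>_def E_def add_ac)
  have idx: "int n - int (Suc j) = J - 1" "int n - int (Suc i) = I - 1" by (simp_all add: J_def I_def)
  \<comment> \<open>\<open>e\<close> is symmetric in the first two variables; \<open>e_swap\<close>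
    lets \<open>line_difference\<close> be used for site 2 with their roles exchanged.\<close>
  have e_app: "E k + (x 1 + x 2) * E (k - 1) + x 1 * x 2 * E (k - 2) = e k"
    and e_swap: "e k = E k + (x 2 + x 1) * E (k - 1) + x 2 * x 1 * E (k - 2)"
    and \<sigma>_app: "\<sigma> k = E k * E k - E (k + 1) * E (k - 1)"
    and \<tau>_app: "\<tau> k = E (k + 1) * E k - E (k + 2) * E (k - 1)" for k
    by (simp_all add: e_def \<sigma>_def \<tau>_def algebra_simps)
  note e_eq = elem_sym_rec[OF n x \<pi>, folded E_def, unfolded e_app]
    and e_pos = rec_pos[OF n x \<pi>, folded E_def, unfolded e_app]
    and queue_diff = queue_difference[where E=E and a="x 1" and b="x 2", OF e_app[symmetric] \<sigma>_app \<tau>_app]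
    and diff1 = line_difference[where E=E and a="x 1" and b="x 2", OF e_app[symmetric] \<sigma>_app \<tau>_app]
    and diff2 = line_difference[where E=E and a="x 2" and b="x 1", OF e_swap \<sigma>_app \<tau>_app]
  have es: "elem_sym n x (n - j) = e J" "elem_sym n x (n - j - 1) = e (J - 1)"
    "elem_sym n x (n - i) = e I" "elem_sym n x (n - i - 1) = e (I - 1)"
    using e_eq[OF ji(1)] e_eq[OF ji(2)] e_eq[OF ji(3)] e_eq[OF ji(4)]
    by (simp_all only: idx J_def[symmetric] I_def[symmetric]) simp_all
  have esl: "elem_sym_list n x [n - j, n - j - 1, n - i, n - i - 1] = e J * e (J - 1) * e I * e (I - 1)"
    "elem_sym_list n x [n - i, n - i - 1, n - j, n - j - 1] = e I * e (I - 1) * e J * e (J - 1)"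
    "elem_sym_list n x [n - j, n - j] = e J * e J"
    by (simp_all only: elem_sym_list_def list.map prod_list.Cons prod_list.Nil es mult_1_right mult.assoc)
  have pos: "0 < e J" "0 < e (J - 1)" "0 < e I" "0 < e (I - 1)"
    using e_pos[OF ji(1)] e_pos[OF ji(2)] e_pos[OF ji(3)] e_pos[OF ji(4)]
    by (simp_all only: idx J_def[symmetric] I_def[symmetric])
  note le = level_prob_le[OF n x \<pi>, folded E_def, unfolded e_app]
    and less = level_prob_less[OF n x \<pi>, folded E_def, unfolded e_app]
    and same = level_prob_same[OF n x \<pi>, folded E_def, unfolded e_app]
  note fold_idx = idx J_def[symmetric] I_def[symmetric]
  have P: "?P = level_prob n \<pi> j i - level_prob n \<pi> (Suc j) i - level_prob n \<pi> j (Suc i)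
    + level_prob n \<pi> (Suc j) (Suc i)"
    by (rule expectation_occ[OF n \<pi>])
  have case_less: "?P = x 1 * x 2 ^ 2 *
      (f_fun n j i x / elem_sym_list n x [n - j, n - j - 1, n - i, n - i - 1])" if "j < i"
  proof -
    define N where "N = (\<lambda>q p. E (q - 2) * (x 2 * E (p - 1) + x 1 * x 2 * E (p - 2))
      + E q * E (p - 2) + x 1 * E (q - 1) * E (p - 2))"
    have N: "level_prob n \<pi> t u = x 1 * x 2 * N (int n - int t) (int n - int u) /
        (e (int n - int u) * e (int n - int t))" if "t \<le> u" "u \<le> n" for t u
      using le[OF that] by (simp only: N_def)
    \<comment> \<open>Since \<open>Suc j \<le> i\<close>, site 1 has the smaller or equal threshold
      in all four terms.\<close>
    have "?P = x 1 * x 2 * N J I / (e I * e J) - x 1 * x 2 * N (J - 1) I / (e I * e (J - 1))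
        - x 1 * x 2 * N J (I - 1) / (e (I - 1) * e J)
        + x 1 * x 2 * N (J - 1) (I - 1) / (e (I - 1) * e (J - 1))"
      unfolding P using N[of j i] N[of "Suc j" i] N[of j "Suc i"] N[of "Suc j" "Suc i"] \<open>j < i\<close> ji
      by (simp only: fold_idx)
    also have "\<dots> = x 1 * x 2 * (N J I * (e (I - 1) * e (J - 1)) - N (J - 1) I * (e (I - 1) * e J)
      - N J (I - 1) * (e I * e (J - 1)) + N (J - 1) (I - 1) * (e I * e J))
      / (e J * e (J - 1) * e I * e (I - 1))"
      using pos by (simp add: divide_simps) (simp add: algebra_simps)
    \<comment> \<open>The difference contributes a further factor \<open>x 2\<close>, whence the
      prefactor \<open>x 1 * x 2 ^ 2\<close>.\<close>
    also have "N J I * (e (I - 1) * e (J - 1)) - N (J - 1) I * (e (I - 1) * e J)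
      - N J (I - 1) * (e I * e (J - 1)) + N (J - 1) (I - 1) * (e I * e J) = x 2 * f_fun n j i x"
      unfolding N_def queue_diff f_fun_eq Let_def schur fold_idx ..
    finally show ?thesis
      unfolding esl by (simp add: power2_eq_square mult_ac)
  qed
  \<comment> \<open>The one-site probabilities at sites 1 and 2, as functions of the size of the
    level.\<close>
  define A B where "A = (\<lambda>p. x 1 * (E (p - 1) + x 2 * E (p - 2)) / e p)"
    and "B = (\<lambda>q. x 2 * (E (q - 1) + x 1 * E (q - 2)) / e q)"
  have AB: "level_prob n \<pi> t u = A (int n - int t) * B (int n - int u)" if "u < t" "t \<le> n" for t u
    using less[OF that] by (simp only: A_def B_def)
  have A_diff: "A J - A (J - 1) =
      x 1 * (x 2 ^ 2 * \<sigma> (J - 2) + x 2 * \<tau> (J - 2) + \<sigma> (J - 1)) / (e J * e (J - 1))"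
  proof -
    have "A J - A (J - 1) = x 1 * ((E (J - 1) + x 2 * E (J - 2)) * e (J - 1)
        - (E (J - 2) + x 2 * E (J - 3)) * e J) / (e J * e (J - 1))"
      unfolding A_def using pos by (simp add: divide_simps) (simp add: algebra_simps)
    then show ?thesis by (simp only: diff1)
  qed
  have B_diff: "B I - B (I - 1) =
      x 2 * (x 1 ^ 2 * \<sigma> (I - 2) + x 1 * \<tau> (I - 2) + \<sigma> (I - 1)) / (e I * e (I - 1))"
  proof -
    have "B I - B (I - 1) = x 2 * ((E (I - 1) + x 1 * E (I - 2)) * e (I - 1)
        - (E (I - 2) + x 1 * E (I - 3)) * e I) / (e I * e (I - 1))"
      unfolding B_def using pos by (simp add: divide_simps) (simp add: algebra_simps)
    then show ?thesis by (simp only: diff2)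
  qed
  have prod: "(A J - A (J - 1)) * (B I - B (I - 1)) =
      g_fun n j i x / (e I * e (I - 1) * e J * e (J - 1))"
    unfolding A_diff B_diff g_fun_eq Let_def schur fold_idx by (simp add: mult_ac)
  have case_greater: "?P = g_fun n j i x / elem_sym_list n x [n - i, n - i - 1, n - j, n - j - 1]"
    if "i + 1 < j"
  proof -
    have "?P = (A J - A (J - 1)) * (B I - B (I - 1))"
      unfolding P using AB[of i j] AB[of i "Suc j"] AB[of "Suc i" j] AB[of "Suc i" "Suc j"] that ji
      by (simp only: fold_idx) (simp add: algebra_simps)
    then show ?thesis unfolding prod esl .
  qed
  have case_succ: "?P = g_fun n (i + 1) i x / elem_sym_list n x [n - i, n - i - 1, n - i - 1, n - i - 2]
      + x 1 * x 2 * (schur12 0 (int n - int j - 1) (xs_from3 n x) / elem_sym_list n x [n - j, n - j])"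
    if j: "j = i + 1"
  proof -
    have J: "I = J + 1" using j by (simp add: I_def J_def)
    \<comment> \<open>The term with thresholds \<open>j\<close> and \<open>Suc i = j\<close> is the
      only one where independence fails; the last bracket replaces \<open>A J * B J\<close> by its
      true value.\<close>
    have "?P = (A J - A (J - 1)) * (B I - B (I - 1)) + (A J * B J - x 1 * x 2 * E (J - 2) / e J)"
    proof -
      have lt: "i < j" "i < Suc j" "j < Suc j" "Suc i = j" using j by auto
      have "level_prob n \<pi> j i = A J * B I" "level_prob n \<pi> (Suc j) i = A (J - 1) * B I"
        "level_prob n \<pi> (Suc j) (Suc i) = A (J - 1) * B J"
        "level_prob n \<pi> j (Suc i) = x 1 * x 2 * E (J - 2) / e J"
        using AB[OF lt(1) ji(1)] AB[OF lt(2) ji(2)] AB[OF lt(3) ji(2)] same[OF ji(1)]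
        unfolding lt(4) fold_idx by blast+
      then show ?thesis unfolding P J by (simp add: algebra_simps)
    qed
    also have "A J * B J - x 1 * x 2 * E (J - 2) / e J = x 1 * x 2 * (\<sigma> (J - 1) / (e J * e J))"
    proof -
      \<comment> \<open>All terms containing \<open>x 1\<close> or \<open>x 2\<close> cancel,
        leaving \<open>E (J - 1) ^ 2 - E J * E (J - 2)\<close>.\<close>
      have "(E (J - 1) + x 2 * E (J - 2)) * (E (J - 1) + x 1 * E (J - 2)) - E (J - 2) * e J = \<sigma> (J - 1)"
        by (simp add: e_def \<sigma>_def algebra_simps)
      then have "x 1 * x 2 * (\<sigma> (J - 1) / (e J * e J)) = x 1 * x 2 *
          (((E (J - 1) + x 2 * E (J - 2)) * (E (J - 1) + x 1 * E (J - 2)) - E (J - 2) * e J) / (e J * e J))"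
        by (simp only:)
      also have "\<dots> = A J * B J - x 1 * x 2 * E (J - 2) / e J"
        unfolding A_def B_def using pos by (simp add: divide_simps) (simp add: algebra_simps)
      finally show ?thesis by (rule sym)
    qed
    finally show ?thesis
      unfolding prod schur esl(2)[symmetric] esl(3) J_def[symmetric] using j by simp
  qed
  show ?thesis
    unfolding Let_def
    using case_less case_greater case_succ expectation_occ_same[OF n \<pi>] by blast
qed

end
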